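(* Let $K\in(0,1)$, let $X^K$ be the centered Gaussian process and $B^{o,K/2}$, $B^{e,K/2}$ the odd and even parts of the fractional Brownian motion with Hurst index $K/2$ as defined in the context, and let $C_3=2\Gamma(1-K)K^{-1}$. If $X^K$ and $B^{o,K/2}$ are independent, then $$\left(C_3^{-1/2}X^K_t+B^{o,K/2}_t,\ t\ge0\right)\quad\text{and}\quad\left(B^{e,K/2}_t,\ t\ge 0\right)$$ have the same finite dimensional distributions.
   Context: For $K\in(0,1)$, $X^K=(X^K_t,\ t\ge0)$ is the centered Gaussian process $X^K_t=\int_0^\infty(1-e^{-\theta t})\theta^{-(1+K)/2}\,dW_\theta$ with $W$ a standard Brownian motion; its covariance is $E[X^K_tX^K_s]=\Gamma(1-K)K^{-1}\left(t^K+s^K-(t+s)^K\right)$, $s,t\ge0$. $B^{K/2}=(B^{K/2}_t,\ t\in\mathbb{R})$ is the two-sided fractional Brownian motion with Hurst index $K/2$, i.e. the centered Gaussian process with covariance $\frac12\left(|t|^K+|s|^K-|t-s|^K\right)$, $s,t\in\mathbb{R}$. For $t\ge0$, its odd and even parts are $B^{o,K/2}_t=\frac12\left(B^{K/2}_t-B^{K/2}_{-t}\right)$ and $B^{e,K/2}_t=\frac12\left(B^{K/2}_t+B^{K/2}_{-t}\right)$. *)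

theory Defs
  imports "HOL-Probability.Probability"
begin

text \<open>Real-valued processes are functions \<open>X :: real \<Rightarrow> 'a \<Rightarrow> real\<close> (time first); only the times
  in an explicitly given set are relevant.\<close>

definition same_fdd ::
  "'a measure \<Rightarrow> 'b measure \<Rightarrow> real set \<Rightarrow> (real \<Rightarrow> 'a \<Rightarrow> real) \<Rightarrow> (real \<Rightarrow> 'b \<Rightarrow> real) \<Rightarrow> bool" where
  "same_fdd M N T X Y \<longleftrightarrow>
     (\<forall>J. finite J \<and> J \<subseteq> T \<longrightarrow>
        distr M (\<Pi>\<^sub>M t\<in>J. borel) (\<lambda>\<omega>. \<lambda>t\<in>J. X t \<omega>) =
        distr N (\<Pi>\<^sub>M t\<in>J. borel) (\<lambda>\<omega>. \<lambda>t\<in>J. Y t \<omega>))"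

definition indep_processes ::
  "'a measure \<Rightarrow> real set \<Rightarrow> (real \<Rightarrow> 'a \<Rightarrow> real) \<Rightarrow> (real \<Rightarrow> 'a \<Rightarrow> real) \<Rightarrow> bool" where
  "indep_processes M T X Y \<longleftrightarrow>
     prob_space.indep_var M (\<Pi>\<^sub>M t\<in>T. borel) (\<lambda>\<omega>. \<lambda>t\<in>T. X t \<omega>)
                            (\<Pi>\<^sub>M t\<in>T. borel) (\<lambda>\<omega>. \<lambda>t\<in>T. Y t \<omega>)"

text \<open>Constants count as (degenerate) Gaussian variables.\<close>

definition gaussian_rv :: "'a measure \<Rightarrow> ('a \<Rightarrow> real) \<Rightarrow> bool" where
  "gaussian_rv M Y \<longleftrightarrow> Y \<in> borel_measurable M \<and>
     ((\<exists>\<mu> \<sigma>. \<sigma> > 0 \<and> distributed M lborel Y (normal_density \<mu> \<sigma>)) \<or>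
      (\<exists>\<mu>. AE \<omega> in M. Y \<omega> = \<mu>))"

definition centered_gaussian_process ::
  "'a measure \<Rightarrow> real set \<Rightarrow> (real \<Rightarrow> 'a \<Rightarrow> real) \<Rightarrow> bool" where
  "centered_gaussian_process M T X \<longleftrightarrow>
     (\<forall>J a. finite J \<and> J \<subseteq> T \<longrightarrow> gaussian_rv M (\<lambda>\<omega>. \<Sum>t\<in>J. a t * X t \<omega>)) \<and>
     (\<forall>t\<in>T. prob_space.expectation M (X t) = 0)"

definition two_sided_fbm :: "'a measure \<Rightarrow> real \<Rightarrow> (real \<Rightarrow> 'a \<Rightarrow> real) \<Rightarrow> bool" where
  "two_sided_fbm M H B \<longleftrightarrow>
     centered_gaussian_process M UNIV B \<and>
     (\<forall>s t. prob_space.expectation M (\<lambda>\<omega>. B s \<omega> * B t \<omega>) =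
        (\<bar>t\<bar> powr (2 * H) + \<bar>s\<bar> powr (2 * H) - \<bar>t - s\<bar> powr (2 * H)) / 2)"

definition odd_part :: "(real \<Rightarrow> 'a \<Rightarrow> real) \<Rightarrow> real \<Rightarrow> 'a \<Rightarrow> real" where
  "odd_part B t \<omega> = (B t \<omega> - B (- t) \<omega>) / 2"

definition even_part :: "(real \<Rightarrow> 'a \<Rightarrow> real) \<Rightarrow> real \<Rightarrow> 'a \<Rightarrow> real" where
  "even_part B t \<omega> = (B t \<omega> + B (- t) \<omega>) / 2"

definition standard_brownian_motion :: "'a measure \<Rightarrow> (real \<Rightarrow> 'a \<Rightarrow> real) \<Rightarrow> bool" where
  "standard_brownian_motion M W \<longleftrightarrow>
     (\<forall>t\<ge>0. W t \<in> borel_measurable M) \<and>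
     (AE \<omega> in M. W 0 \<omega> = 0) \<and>
     (\<forall>n (t :: nat \<Rightarrow> real). 0 \<le> t 0 \<and> (\<forall>i<n. t i < t (Suc i)) \<longrightarrow>
        prob_space.indep_vars M (\<lambda>_. borel) (\<lambda>i \<omega>. W (t (Suc i)) \<omega> - W (t i) \<omega>) {..<n}) \<and>
     (\<forall>s t. 0 \<le> s \<and> s < t \<longrightarrow>
        distributed M lborel (\<lambda>\<omega>. W t \<omega> - W s \<omega>) (normal_density 0 (sqrt (t - s)))) \<and>
     (AE \<omega> in M. continuous_on {0..} (\<lambda>t. W t \<omega>))"

text \<open>A list of triples \<open>(c, a, b)\<close> with \<open>0 \<le> a \<le> b\<close> encodes the step function
  \<open>\<Sum> c 1\<^bsub>(a,b]\<^esub>\<close> on the half-line; the intervals may overlap.\<close>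

definition valid_step :: "(real \<times> real \<times> real) list \<Rightarrow> bool" where
  "valid_step p \<longleftrightarrow> (\<forall>(c, a, b) \<in> set p. 0 \<le> a \<and> a \<le> b)"

definition step_fun :: "(real \<times> real \<times> real) list \<Rightarrow> real \<Rightarrow> real" where
  "step_fun p \<theta> = (\<Sum>(c, a, b)\<leftarrow>p. c * indicator {a<..b} \<theta>)"

definition step_integral ::
  "(real \<Rightarrow> 'a \<Rightarrow> real) \<Rightarrow> (real \<times> real \<times> real) list \<Rightarrow> 'a \<Rightarrow> real" where
  "step_integral W p \<omega> = (\<Sum>(c, a, b)\<leftarrow>p. c * (W b \<omega> - W a \<omega>))"

text \<open>\<open>Y\<close> is a version of the Wiener integral of \<open>f\<close> over \<open>[0, \<infinity>)\<close> with respect to \<open>W\<close>: the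
  \<open>L\<^sup>2\<close> limit of the integrals of step functions converging to \<open>f\<close> in \<open>L\<^sup>2\<close>. By the isometry
  property \<open>Y\<close> is determined up to null sets and does not depend on the chosen sequence. The
  distances are extended nonnegative integrals, so convergence to 0 entails square integrability
  of \<open>f\<close> and \<open>Y\<close>.\<close>

definition has_wiener_integral ::
  "'a measure \<Rightarrow> (real \<Rightarrow> 'a \<Rightarrow> real) \<Rightarrow> (real \<Rightarrow> real) \<Rightarrow> ('a \<Rightarrow> real) \<Rightarrow> bool" where
  "has_wiener_integral M W f Y \<longleftrightarrow>
     f \<in> borel_measurable borel \<and> Y \<in> borel_measurable M \<and>
     (\<exists>p. (\<forall>n::nat. valid_step (p n)) \<and>
        (\<lambda>n. \<integral>\<^sup>+\<theta>\<in>{0..}. ennreal ((step_fun (p n) \<theta> - f \<theta>)\<^sup>2) \<partial>lborel) \<longlonglongrightarrow> 0 \<and>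
        (\<lambda>n. \<integral>\<^sup>+\<omega>. ennreal ((step_integral W (p n) \<omega> - Y \<omega>)\<^sup>2) \<partial>M) \<longlonglongrightarrow> 0)"

definition process_X ::
  "'a measure \<Rightarrow> real \<Rightarrow> (real \<Rightarrow> 'a \<Rightarrow> real) \<Rightarrow> (real \<Rightarrow> 'a \<Rightarrow> real) \<Rightarrow> bool" where
  "process_X M K W X \<longleftrightarrow>
     (\<forall>t\<ge>0. has_wiener_integral M W
        (\<lambda>\<theta>. (1 - exp (- \<theta> * t)) * \<theta> powr (- (1 + K) / 2)) (X t))"

definition C3 :: "real \<Rightarrow> real" where
  "C3 K = 2 * Gamma (1 - K) / K"

end

(* Both processes are centered Gaussian and their covariances agree, so every finite linear
   combination has the same characteristic function on both sides; the Cramer-Wold device turns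
   this into equality of the finite dimensional distributions. For X the characteristic function is
   exact for step integrals, by independence of the increments of W, and passes to the L2 limit; the
   covariance integral follows from (1 - e^(-xt))(1 - e^(-xs)) = (1 - e^(-xt)) + (1 - e^(-xs))
   - (1 - e^(-x(t+s))). *)

theory Submission
  imports Defs
begin

text \<open>The normalisation comes from comparing covariances. For \<open>H = K / 2\<close> the odd
  part has covariance \<open>((t + s) powr K - \<bar>t - s\<bar> powr K) / 4\<close> and the even
  part \<open>(2 * t powr K + 2 * s powr K - (t + s) powr K - \<bar>t - s\<bar> powr K) / 4\<close>.
  The difference is half of \<open>t powr K + s powr K - (t + s) powr K\<close>, which is the
  covariance of \<open>X\<close> divided by \<open>C3 K\<close>; independence makes the covariances
  of the two summands add. The obstacle is that each \<open>X t\<close> is given only as an L2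
  limit, with an approximating sequence of its own, and that densities, on which
  \<open>gaussian_rv\<close> rests, do not pass readily to such limits. Hence
  \<open>gaussian_rv\<close> is never established for \<open>X\<close>: the approximants of finitely
  many times are merged into one step function, and the Gaussian law and the covariance of
  \<open>X\<close> appear together in the exponent of the limiting characteristic function.\<close>

section \<open>The Cramer-Wold device\<close>

text \<open>Divided by its total mass, the image under \<open>Y\<close> of the measure with density
  \<open>w\<close> is a probability distribution on the line whose characteristic function is the
  weighted transform, so the classical uniqueness theorem applies.\<close>

lemma weighted_Levy_uniqueness:
  fixes w :: "'a \<Rightarrow> real" and w' :: "'b \<Rightarrow> real"
  assumes "finite_measure M" "finite_measure N"
    and w: "integrable M w" "\<And>x. 0 \<le> w x"
    and w': "integrable N w'" "\<And>x. 0 \<le> w' x"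
    and Y [measurable]: "Y \<in> borel_measurable M" and Y' [measurable]: "Y' \<in> borel_measurable N"
    and eq: "\<And>u. (CLINT x|M. w x * iexp (u * Y x)) = (CLINT x|N. w' x * iexp (u * Y' x))"
    and A [measurable]: "A \<in> sets borel"
  shows "(LINT x|M. w x * indicator A (Y x)) = (LINT x|N. w' x * indicator A (Y' x))"
proof -
  have [measurable]: "w \<in> borel_measurable M" "w' \<in> borel_measurable N"
    using w w' by auto
  define c where "c = (LINT x|M. w x)"
  \<comment> \<open>At frequency 0 the transforms are the total masses, so one constant normalises
    both sides. Mass 0 cannot be normalised and is treated apart.\<close>
  have c': "c = (LINT x|N. w' x)"
    using eq[of 0] by (simp add: c_def)
  have c0: "c \<ge> 0" unfolding c_def using w(2) by (intro integral_nonneg_AE) auto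
  show ?thesis
  proof (cases "c = 0")
    case True
    have "AE x in M. w x = 0"
      using integral_nonneg_eq_0_iff_AE[OF w(1)] w(2) True c_def by auto
    then have 1: "(LINT x|M. w x * indicator A (Y x)) = 0"
      by (intro integral_eq_zero_AE) auto
    have "AE x in N. w' x = 0"
      using integral_nonneg_eq_0_iff_AE[OF w'(1)] w'(2) True c' by auto
    then have 2: "(LINT x|N. w' x * indicator A (Y' x)) = 0"
      by (intro integral_eq_zero_AE) auto
    show ?thesis using 1 2 by simp
  next
    case False
    then have c: "c > 0" using c0 by simp
    \<comment> \<open>Stated for a generic measure \<open>L\<close>, because it is instantiated with
      \<open>M\<close> and with \<open>N\<close>, which live on different types.\<close>
    have *: "real_distribution (distr (density L (\<lambda>x. ennreal (v x / c))) borel V)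
       \<and> char (distr (density L (\<lambda>x. ennreal (v x / c))) borel V) u = (CLINT x|L. v x * iexp (u * V x)) / c
       \<and> measure (distr (density L (\<lambda>x. ennreal (v x / c))) borel V) A = (LINT x|L. v x * indicator A (V x)) / c"
      if v: "integrable L v" "\<And>x. 0 \<le> v x" and [measurable]: "V \<in> borel_measurable L"
        and cv: "c = (LINT x|L. v x)" for L :: "'c measure" and v V u
    proof -
      have [measurable]: "v \<in> borel_measurable L" using v by auto
      have "emeasure (density L (\<lambda>x. ennreal (v x / c))) (space L) = (\<integral>\<^sup>+x. ennreal (v x / c) \<partial>L)"
        by (subst emeasure_density) (auto intro!: nn_integral_cong)
      also have "\<dots> = ennreal (LINT x|L. v x / c)"
        using v c by (intro nn_integral_eq_integral) auto
      also have "\<dots> = 1" using cv c by simp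
      finally have "prob_space (density L (\<lambda>x. ennreal (v x / c)))"
        by (intro prob_spaceI) simp
      then have 1: "real_distribution (distr (density L (\<lambda>x. ennreal (v x / c))) borel V)"
        by (intro prob_space.real_distribution_distr) auto
      have "char (distr (density L (\<lambda>x. ennreal (v x / c))) borel V) u = (CLINT x|L. (v x / c) *\<^sub>R iexp (u * V x))"
        unfolding char_def using v c
        by (subst integral_distr) (auto simp: integral_density simp del: scaleR_conv_of_real)
      also have "\<dots> = (CLINT x|L. (v x * iexp (u * V x)) / c)"
        by (intro Bochner_Integration.integral_cong) (auto simp: scaleR_conv_of_real)
      finally have 2: "char (distr (density L (\<lambda>x. ennreal (v x / c))) borel V) u = (CLINT x|L. v x * iexp (u * V x)) / c"
        by simp
      have "measure (distr (density L (\<lambda>x. ennreal (v x / c))) borel V) A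
         = (LINT x|distr (density L (\<lambda>x. ennreal (v x / c))) borel V. indicator A x)"
        by simp
      also have "\<dots> = (LINT x|L. (v x / c) *\<^sub>R indicator A (V x))"
        using v c by (subst integral_distr) (auto simp: integral_density)
      finally have 3: "measure (distr (density L (\<lambda>x. ennreal (v x / c))) borel V) A = (LINT x|L. v x * indicator A (V x)) / c"
        by simp
      show ?thesis using 1 2 3 by blast
    qed
    note a = *[OF w Y c_def] and b = *[OF w' Y' c']
    have "distr (density M (\<lambda>x. ennreal (w x / c))) borel Y = distr (density N (\<lambda>x. ennreal (w' x / c))) borel Y'"
      using a b eq by (intro Levy_uniqueness ext) auto
    then show ?thesis using a b c by (auto simp: field_simps)
  qed
qed

text \<open>Reduced to nonnegative weights through \<open>1 + Re w\<close>: its transform is a combination of those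
  of \<open>1\<close>, \<open>w\<close> and \<open>cnj w\<close>, and the last one is determined by that of \<open>w\<close>.\<close>

lemma complex_weighted_Levy_uniqueness:
  fixes w :: "'a \<Rightarrow> complex" and w' :: "'b \<Rightarrow> complex"
  assumes M: "finite_measure M" and N: "finite_measure N"
    and w [measurable]: "w \<in> borel_measurable M" and w1: "\<And>x. norm (w x) \<le> 1"
    and w' [measurable]: "w' \<in> borel_measurable N" and w1': "\<And>x. norm (w' x) \<le> 1"
    and Y [measurable]: "Y \<in> borel_measurable M" and Y' [measurable]: "Y' \<in> borel_measurable N"
    and eq1: "\<And>u. (CLINT x|M. iexp (u * Y x)) = (CLINT x|N. iexp (u * Y' x))"
    and eq: "\<And>u. (CLINT x|M. w x * iexp (u * Y x)) = (CLINT x|N. w' x * iexp (u * Y' x))"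
    and A [measurable]: "A \<in> sets borel"
  shows "(CLINT x|M. w x * indicator A (Y x)) = (CLINT x|N. w' x * indicator A (Y' x))"
proof -
  interpret M: finite_measure M by fact
  interpret N: finite_measure N by fact
  have real_part: "(LINT x|M. Re (v x) * indicator A (Y x)) = (LINT x|N. Re (v' x) * indicator A (Y' x))"
    if [measurable]: "v \<in> borel_measurable M" "v' \<in> borel_measurable N"
      and v1: "\<And>x. norm (v x) \<le> 1" and v1': "\<And>x. norm (v' x) \<le> 1"
      and v: "\<And>u. (CLINT x|M. v x * iexp (u * Y x)) = (CLINT x|N. v' x * iexp (u * Y' x))" for v v'
  proof -
    have R: "\<bar>Re (v x)\<bar> \<le> 1" "\<bar>Re (v' y)\<bar> \<le> 1" for x y
      using abs_Re_le_cmod v1 v1' order_trans by metis+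
    have iM: "integrable M (\<lambda>x. Re (v x))" "integrable M (\<lambda>x. Re (v x) * indicator A (Y x))"
      "integrable M (\<lambda>x. indicator A (Y x) :: real)"
      "integrable M (\<lambda>x. v x * iexp (u * Y x))" "integrable M (\<lambda>x. iexp (u * Y x))" for u
      by (rule M.integrable_const_bound[where B=1]; use R v1 in \<open>simp add: indicator_def norm_mult\<close>)+
    have iM': "integrable M (\<lambda>x. cnj (v x) * iexp (u * Y x))" for u
      using integrable_cnj[of M "\<lambda>x. v x * iexp (- u * Y x)"] iM(4)[of "- u"] by (simp add: exp_cnj)
    have iN: "integrable N (\<lambda>x. Re (v' x))" "integrable N (\<lambda>x. Re (v' x) * indicator A (Y' x))"
      "integrable N (\<lambda>x. indicator A (Y' x) :: real)"
      "integrable N (\<lambda>x. v' x * iexp (u * Y' x))" "integrable N (\<lambda>x. iexp (u * Y' x))" for u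
      by (rule N.integrable_const_bound[where B=1]; use R v1' in \<open>simp add: indicator_def norm_mult\<close>)+
    have iN': "integrable N (\<lambda>x. cnj (v' x) * iexp (u * Y' x))" for u
      using integrable_cnj[of N "\<lambda>x. v' x * iexp (- u * Y' x)"] iN(4)[of "- u"] by (simp add: exp_cnj)
    \<comment> \<open>The transform of the conjugate weight at \<open>u\<close> is the conjugate of
      the transform of the weight at \<open>- u\<close>.\<close>
    have cn: "(CLINT x|M. cnj (v x) * iexp (u * Y x)) = (CLINT x|N. cnj (v' x) * iexp (u * Y' x))" for u
    proof -
      have "(CLINT x|M. cnj (v x) * iexp (u * Y x)) = (CLINT x|M. cnj (v x * iexp ((- u) * Y x)))"
        by (simp add: exp_cnj)
      also have "\<dots> = (CLINT x|N. cnj (v' x * iexp ((- u) * Y' x)))"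
        using v[of "- u"] by (simp add: integral_cnj del: complex_cnj_mult)
      also have "\<dots> = (CLINT x|N. cnj (v' x) * iexp (u * Y' x))"
        by (simp add: exp_cnj)
      finally show ?thesis .
    qed
    have split: "complex_of_real (1 + Re z) * e = e + (z * e + cnj z * e) / 2" for z e :: complex
      by (simp add: distrib_right[symmetric] complex_add_cnj) (simp add: distrib_right)
    have "(LINT x|M. (1 + Re (v x)) * indicator A (Y x)) = (LINT x|N. (1 + Re (v' x)) * indicator A (Y' x))"
    proof (rule weighted_Levy_uniqueness[OF M N])
      show "(CLINT x|M. complex_of_real (1 + Re (v x)) * iexp (u * Y x))
          = (CLINT x|N. complex_of_real (1 + Re (v' x)) * iexp (u * Y' x))" for u
        unfolding split using iM iN iM' iN' by (simp add: v cn eq1 del: of_real_mult)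
      show "0 \<le> 1 + Re (v x)" "0 \<le> 1 + Re (v' y)" for x y
        using R(1)[of x] R(2)[of y] by auto
    qed (use iM iN in auto)
    \<comment> \<open>Weight 1 is nonnegative too; subtracting its contribution leaves
      \<open>Re v\<close> alone.\<close>
    moreover have "(LINT x|M. 1 * indicator A (Y x)) = (LINT x|N. 1 * indicator A (Y' x) :: real)"
      by (rule weighted_Levy_uniqueness[OF M N]) (simp_all add: eq1 del: of_real_mult)
    ultimately show ?thesis
      using iM iN by (simp add: distrib_right)
  qed
  have R: "(LINT x|M. Re (w x) * indicator A (Y x)) = (LINT x|N. Re (w' x) * indicator A (Y' x))"
    by (rule real_part) (use w1 w1' eq in auto)
  \<comment> \<open>The imaginary part of \<open>w\<close> is the real part of
    \<open>- \<i> * w\<close>, a weight with the same bound and again equal transforms.\<close>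
  have "(CLINT x|M. - \<i> * w x * iexp (u * Y x)) = (CLINT x|N. - \<i> * w' x * iexp (u * Y' x))" for u
    using eq[of u] by (simp add: mult.assoc)
  then have "(LINT x|M. Re (- \<i> * w x) * indicator A (Y x)) = (LINT x|N. Re (- \<i> * w' x) * indicator A (Y' x))"
    by (intro real_part) (use w1 w1' in \<open>auto simp: norm_mult\<close>)
  then have I: "(LINT x|M. Im (w x) * indicator A (Y x)) = (LINT x|N. Im (w' x) * indicator A (Y' x))"
    by simp
  have iM: "integrable M (\<lambda>x. w x * indicator A (Y x))"
    using w1 by (auto intro!: M.integrable_const_bound[where B=1] simp: indicator_def norm_mult)
  have iN: "integrable N (\<lambda>x. w' x * indicator A (Y' x))"
    using w1' by (auto intro!: N.integrable_const_bound[where B=1] simp: indicator_def norm_mult)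
  have ReIm: "Re (z * indicator A y) = Re z * indicator A y" "Im (z * indicator A y) = Im z * indicator A y" for z y
    by (auto simp: indicator_def)
  show ?thesis
    using R I unfolding complex_eq_iff integral_Re[OF iM, symmetric] integral_Re[OF iN, symmetric] 
      integral_Im[OF iM, symmetric] integral_Im[OF iN, symmetric] ReIm by simp
qed

text \<open>One coordinate after another, the exponential factor is exchanged for an indicator by
  one-dimensional uniqueness, the remaining factors serving as a complex weight.\<close>

lemma Cramer_Wold:
  fixes Z :: "'i \<Rightarrow> 'a \<Rightarrow> real" and Z' :: "'i \<Rightarrow> 'b \<Rightarrow> real"
  assumes M: "prob_space M" and N: "prob_space N" and J: "finite J"
    and Z [measurable]: "\<And>j. j \<in> J \<Longrightarrow> Z j \<in> borel_measurable M"
    and Z' [measurable]: "\<And>j. j \<in> J \<Longrightarrow> Z' j \<in> borel_measurable N"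
    and eq: "\<And>a. (CLINT x|M. iexp (\<Sum>j\<in>J. a j * Z j x)) = (CLINT x|N. iexp (\<Sum>j\<in>J. a j * Z' j x))"
  shows "distr M (\<Pi>\<^sub>M j\<in>J. borel) (\<lambda>x. \<lambda>j\<in>J. Z j x) = distr N (\<Pi>\<^sub>M j\<in>J. borel) (\<lambda>x. \<lambda>j\<in>J. Z' j x)"
proof -
  interpret M: prob_space M by fact
  interpret N: prob_space N by fact
  have P: "(CLINT x|M. (\<Prod>j\<in>S. indicator (A j) (Z j x)) * iexp (\<Sum>j\<in>J - S. a j * Z j x))
      = (CLINT x|N. (\<Prod>j\<in>S. indicator (A j) (Z' j x)) * iexp (\<Sum>j\<in>J - S. a j * Z' j x))"
    if "S \<subseteq> J" and A: "\<And>j. j \<in> J \<Longrightarrow> A j \<in> sets borel" for S A a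
  proof -
    have "finite S" using that J finite_subset by auto
    then show ?thesis using \<open>S \<subseteq> J\<close>
    proof (induction S arbitrary: a)
      case empty
      then show ?case using eq by simp
    next
      case (insert k S)
      then have k: "k \<in> J" "k \<notin> S" and SJ: "S \<subseteq> J" "finite S" by auto
      note [measurable] = A
      have [measurable]: "k \<in> J" "\<And>j. j \<in> S \<Longrightarrow> j \<in> J" "\<And>j. j \<in> J - insert k S \<Longrightarrow> j \<in> J" using k SJ by auto
      define w where "w z = (\<Prod>j\<in>S. indicator (A j) (z j)) * iexp (\<Sum>j\<in>J - insert k S. a j * z j)"
        for z :: "'i \<Rightarrow> real"
      have w_indicator: "(\<Prod>j\<in>insert k S. indicator (A j) (z j)) * iexp (\<Sum>j\<in>J - insert k S. a j * z j)
        = w z * indicator (A k) (z k)" for z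
        using k SJ by (simp add: w_def mult_ac)
      \<comment> \<open>With the exponential of coordinate \<open>k\<close> put back, the integrand
        is that of the induction hypothesis for \<open>S\<close>, with coefficient \<open>u\<close>
        at \<open>k\<close>. This is why the induction generalises over \<open>a\<close>.\<close>
      have w_iexp: "w z * iexp (u * z k) = (\<Prod>j\<in>S. indicator (A j) (z j)) * iexp (\<Sum>j\<in>J - S. (a(k := u)) j * z j)" for z u
      proof -
        have eq: "J - S = insert k (J - insert k S)" using k by auto
        have "(\<Sum>j\<in>J - S. (a(k := u)) j * z j) = u * z k + (\<Sum>j\<in>J - insert k S. (a(k := u)) j * z j)"
          by (subst eq, subst sum.insert) (use J in auto)
        also have "(\<Sum>j\<in>J - insert k S. (a(k := u)) j * z j) = (\<Sum>j\<in>J - insert k S. a j * z j)"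
          by (intro sum.cong) auto
        finally show ?thesis
          by (simp add: w_def exp_add[symmetric] distrib_left add.commute)
      qed
      have nw: "norm (w z) \<le> 1" for z
        unfolding w_def norm_mult prod_norm[symmetric]
        by (auto simp: indicator_def intro!: prod_le_1)
      have one: "iexp (u * z k) = iexp (\<Sum>j\<in>J. (if j = k then u else 0) * z j)" for z u
      proof -
        have "(\<Sum>j\<in>J. (if j = k then u else 0) * z j) = (\<Sum>j\<in>J. if j = k then u * z k else 0)"
          by (intro sum.cong) auto
        then show ?thesis using J k by simp
      qed
      have "(CLINT x|M. w (\<lambda>j. Z j x) * indicator (A k) (Z k x)) = (CLINT x|N. w (\<lambda>j. Z' j x) * indicator (A k) (Z' k x))"
      proof (rule complex_weighted_Levy_uniqueness)
        show "(\<lambda>x. w (\<lambda>j. Z j x)) \<in> borel_measurable M"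
          unfolding w_def by measurable
        show "(\<lambda>x. w (\<lambda>j. Z' j x)) \<in> borel_measurable N"
          unfolding w_def by measurable
        show "(CLINT x|M. w (\<lambda>j. Z j x) * iexp (u * Z k x)) = (CLINT x|N. w (\<lambda>j. Z' j x) * iexp (u * Z' k x))" for u
          unfolding w_iexp[of "\<lambda>j. Z j x" for x] w_iexp[of "\<lambda>j. Z' j x" for x] by (rule insert.IH) (use SJ in auto)
        show "(CLINT x|M. iexp (u * Z k x)) = (CLINT x|N. iexp (u * Z' k x))" for u
          unfolding one[of _ "\<lambda>j. Z j x" for x] one[of _ "\<lambda>j. Z' j x" for x] by (rule eq)
      qed (use nw A k in \<open>auto intro: M.finite_measure_axioms N.finite_measure_axioms\<close>)
      then show ?case unfolding w_indicator .
    qed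
  qed
  have box: "measure M ((\<lambda>x. \<lambda>j\<in>J. Z j x) -` Pi\<^sub>E J A \<inter> space M) = measure N ((\<lambda>x. \<lambda>j\<in>J. Z' j x) -` Pi\<^sub>E J A \<inter> space N)"
    if A: "\<And>j. j \<in> J \<Longrightarrow> A j \<in> sets borel" for A
  proof -
    \<comment> \<open>At \<open>S = J\<close> the exponential has an empty sum and equals 1, so only
      the indicator of the preimage of the box is left.\<close>
    have *: "(CLINT x|L. (\<Prod>j\<in>J. indicator (A j) (Z j x)) * iexp (\<Sum>j\<in>J - J. 0 * Z j x)) = 
       of_real (measure L ((\<lambda>x. \<lambda>j\<in>J. Z j x) -` Pi\<^sub>E J A \<inter> space L))" 
      for L :: "'c measure" and Z :: "'i \<Rightarrow> 'c \<Rightarrow> real"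
    proof -
      have "(\<Prod>j\<in>J. indicator (A j) (Z j x)) = 
          complex_of_real (indicator ((\<lambda>x. \<lambda>j\<in>J. Z j x) -` Pi\<^sub>E J A \<inter> space L) x)" if "x \<in> space L" for x
        using that J by (auto simp: indicator_def PiE_iff intro!: prod_zero)
      then have "(CLINT x|L. (\<Prod>j\<in>J. indicator (A j) (Z j x)) * iexp (\<Sum>j\<in>J - J. 0 * Z j x)) = 
          (CLINT x|L. complex_of_real (indicator ((\<lambda>x. \<lambda>j\<in>J. Z j x) -` Pi\<^sub>E J A \<inter> space L) x))"
        by (intro Bochner_Integration.integral_cong) auto
      then show ?thesis by (simp del: of_real_indicator add: Int_absorb2)
    qed
    show ?thesis using P[of J A "\<lambda>_. 0"] A unfolding * by simp
  qed
  have [measurable]: "(\<lambda>x. \<lambda>j\<in>J. Z j x) \<in> measurable M (\<Pi>\<^sub>M j\<in>J. borel)"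
     "(\<lambda>x. \<lambda>j\<in>J. Z' j x) \<in> measurable N (\<Pi>\<^sub>M j\<in>J. borel)"
    by (auto intro!: measurable_restrict)
  show ?thesis
  \<comment> \<open>Boxes generate the product sigma-algebra. The measures are finite, so the
    constant sequence of the full box serves as the exhausting sequence.\<close>
  proof (rule measure_eqI_PiM_finite[OF J, where A="\<lambda>_::nat. \<Pi>\<^sub>E j\<in>J. UNIV"])
    fix A :: "'i \<Rightarrow> real set" assume A: "\<And>j. j \<in> J \<Longrightarrow> A j \<in> sets borel"
    have [measurable]: "Pi\<^sub>E J A \<in> sets (\<Pi>\<^sub>M j\<in>J. borel)" using J A by (intro sets_PiM_I_finite) auto
    show "emeasure (distr M (\<Pi>\<^sub>M j\<in>J. borel) (\<lambda>x. \<lambda>j\<in>J. Z j x)) (Pi\<^sub>E J A)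
       = emeasure (distr N (\<Pi>\<^sub>M j\<in>J. borel) (\<lambda>x. \<lambda>j\<in>J. Z' j x)) (Pi\<^sub>E J A)"
      using box[of A] A by (simp add: emeasure_distr M.emeasure_eq_measure N.emeasure_eq_measure)
  next
    show "range (\<lambda>_::nat. \<Pi>\<^sub>E j\<in>J. UNIV) \<subseteq> prod_algebra J (\<lambda>_. borel :: real measure)"
      using J by (auto intro!: prod_algebraI_finite)
    show "emeasure (distr M (\<Pi>\<^sub>M j\<in>J. borel) (\<lambda>x. \<lambda>j\<in>J. Z j x)) (\<Pi>\<^sub>E j\<in>J. UNIV) \<noteq> \<infinity>" for i :: nat
      by (simp add: finite_measure.emeasure_finite[OF M.finite_measure_distr])
  qed (auto simp: space_PiM)
qed

section \<open>Characteristic functions of Gaussian variables\<close>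

lemma integrable_mult_square:
  fixes f g :: "'a \<Rightarrow> real"
  assumes [measurable]: "f \<in> borel_measurable M" "g \<in> borel_measurable M"
    and "integrable M (\<lambda>x. (f x)\<^sup>2)" "integrable M (\<lambda>x. (g x)\<^sup>2)"
  shows "integrable M (\<lambda>x. f x * g x)"
proof (rule Bochner_Integration.integrable_bound)
  show "integrable M (\<lambda>x. (f x)\<^sup>2 + (g x)\<^sup>2)" using assms by simp
  have "\<bar>u * v\<bar> \<le> u\<^sup>2 + v\<^sup>2" for u v :: real
    using sum_squares_bound[of "\<bar>u\<bar>" "\<bar>v\<bar>"] mult_nonneg_nonneg[of "\<bar>u\<bar>" "\<bar>v\<bar>"]
    unfolding abs_mult power2_abs by linarith
  then show "AE x in M. norm (f x * g x) \<le> norm ((f x)\<^sup>2 + (g x)\<^sup>2)" by simp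
qed measurable

lemma (in prob_space) gaussian_rv_square_integrable:
  assumes "gaussian_rv M Y"
  shows "Y \<in> borel_measurable M" "integrable M (\<lambda>x. (Y x)\<^sup>2)" "integrable M Y"
proof -
  show Y [measurable]: "Y \<in> borel_measurable M" using assms by (simp add: gaussian_rv_def)
  show *: "integrable M (\<lambda>x. (Y x)\<^sup>2)"
  proof (cases "\<exists>\<mu>. AE \<omega> in M. Y \<omega> = \<mu>")
    case True
    then obtain \<mu> where \<mu>: "AE \<omega> in M. Y \<omega> = \<mu>" by auto
    then have "AE \<omega> in M. (Y \<omega>)\<^sup>2 = \<mu>\<^sup>2" by auto
    then show ?thesis by (subst integrable_cong_AE[where g="\<lambda>_. \<mu>\<^sup>2"]) auto
  next
    case False
    then obtain \<mu> \<sigma> where s: "\<sigma> > 0" and D: "distributed M lborel Y (normal_density \<mu> \<sigma>)"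
      using assms by (auto simp: gaussian_rv_def)
    \<comment> \<open>The second moment is assembled from the centered moments by \<open>x\<^sup>2 =
      (x - \<mu>)\<^sup>2 + 2 * \<mu> * x - \<mu>\<^sup>2\<close>.\<close>
    have "integrable lborel (\<lambda>x. normal_density \<mu> \<sigma> x * (x - \<mu>)\<^sup>2 + 2 * \<mu> * (normal_density \<mu> \<sigma> x * x) - \<mu>\<^sup>2 * normal_density \<mu> \<sigma> x)"
      by (intro Bochner_Integration.integrable_diff Bochner_Integration.integrable_add integrable_mult_right
        integrable_normal_moment integrable_normal_moment_nz_1 integrable_normal_density s)
    then have "integrable lborel (\<lambda>x. normal_density \<mu> \<sigma> x * x\<^sup>2)"
      by (rule back_subst[where P="integrable lborel"]) (auto simp: power2_eq_square algebra_simps)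
    then show ?thesis
      using distributed_integrable[OF D, of "\<lambda>x. x\<^sup>2"] by simp
  qed
  then show "integrable M Y" by (rule square_integrable_imp_integrable[rotated]) simp
qed

lemma (in prob_space) char_normal:
  assumes s: "\<sigma> > 0" and D: "distributed M lborel Y (normal_density 0 \<sigma>)"
  shows "(CLINT x|M. iexp (u * Y x)) = exp (- (\<sigma>\<^sup>2 * u\<^sup>2 / 2))"
proof -
  have [measurable]: "Y \<in> borel_measurable M" using distributed_measurable[OF D] by simp
  have "distributed M lborel (\<lambda>x. Y x / \<sigma>) std_normal_density"
    using normal_standard_normal_convert[OF s, of Y 0] D by simp
  then have "distr M lborel (\<lambda>x. Y x / \<sigma>) = std_normal_distribution"
    by (simp add: distributed_def)
  then have "char (distr M lborel (\<lambda>x. Y x / \<sigma>)) (u * \<sigma>) = exp (- (\<sigma>\<^sup>2 * u\<^sup>2 / 2))"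
    by (simp add: char_std_normal_distribution power_mult_distrib mult.commute)
  also have "char (distr M lborel (\<lambda>x. Y x / \<sigma>)) (u * \<sigma>) = (CLINT x|M. iexp (u * Y x))"
    unfolding char_def using s by (subst integral_distr) auto
  finally show ?thesis .
qed

text \<open>Frequency 1 suffices, since other frequencies are absorbed into the coefficients of
  linear combinations. In the degenerate case the constant must be 0, and both sides are 1.\<close>

lemma (in prob_space) gaussian_rv_char:
  assumes Y: "gaussian_rv M Y" and mean: "expectation Y = 0"
  shows "(CLINT x|M. iexp (Y x)) = exp (- expectation (\<lambda>x. (Y x)\<^sup>2) / 2)"
proof -
  have [measurable]: "Y \<in> borel_measurable M" using Y by (simp add: gaussian_rv_def)
  show ?thesis
  proof (cases "\<exists>\<mu>. AE \<omega> in M. Y \<omega> = \<mu>")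
    case True
    then obtain \<mu> where \<mu>: "AE \<omega> in M. Y \<omega> = \<mu>" by auto
    then have "expectation Y = expectation (\<lambda>_. \<mu>)" by (intro integral_cong_AE) auto
    then have "\<mu> = 0" using mean by (simp add: prob_space)
    then have 0: "AE \<omega> in M. Y \<omega> = 0" using \<mu> by simp
    have "expectation (\<lambda>x. (Y x)\<^sup>2) = expectation (\<lambda>_. 0)"
      by (rule integral_cong_AE) (use 0 in auto)
    moreover have "(CLINT x|M. iexp (Y x)) = (CLINT x|M. 1)"
      by (rule integral_cong_AE) (use 0 in auto)
    ultimately show ?thesis by (simp add: prob_space)
  next
    case False
    then obtain \<mu> \<sigma> where s: "\<sigma> > 0" and D: "distributed M lborel Y (normal_density \<mu> \<sigma>)"
      using Y by (auto simp: gaussian_rv_def)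
    have "\<mu> = 0" using normal_distributed_expectation[OF s D] mean by simp
    then show ?thesis using char_normal[of \<sigma> Y 1] normal_distributed_variance[OF s D] s D mean
      by simp
  qed
qed

text \<open>In the application \<open>V\<close> is the odd or even part of \<open>X\<close>, which involves the times \<open>t\<close> and \<open>- t\<close>;
  the sum over a set \<open>S\<close> with coefficients \<open>b\<close> takes care of the coincidence at \<open>t = 0\<close>.\<close>

lemma (in prob_space) centered_gaussian_char:
  assumes X: "centered_gaussian_process M T X"
    and J: "finite J" and S: "finite S" "S \<subseteq> T"
    and V: "\<And>t x. t \<in> J \<Longrightarrow> V t x = (\<Sum>s\<in>S. b t s * X s x)"
    and cov: "\<And>t t'. t \<in> J \<Longrightarrow> t' \<in> J \<Longrightarrow> expectation (\<lambda>x. V t x * V t' x) = R t t'"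
  shows "(CLINT x|M. iexp (\<Sum>t\<in>J. a t * V t x)) = exp (- (\<Sum>t\<in>J. \<Sum>t'\<in>J. a t * a t' * R t t') / 2)"
proof -
  have gX: "gaussian_rv M (\<lambda>x. \<Sum>s\<in>S. c s * X s x)" for c
    using X S by (auto simp: centered_gaussian_process_def)
  have gauss: "gaussian_rv M (X s)" if "s \<in> S" for s
    using X that S unfolding centered_gaussian_process_def
    by (auto dest!: spec[of _ "{s}"] spec[of _ "\<lambda>_. 1"])
  have mean: "expectation (\<lambda>x. \<Sum>s\<in>S. c s * X s x) = 0" for c
    using X S gaussian_rv_square_integrable(3)[OF gauss]
    by (subst Bochner_Integration.integral_sum) (auto simp: centered_gaussian_process_def intro!: sum.neutral)
  define Y where "Y = (\<lambda>x. \<Sum>t\<in>J. a t * V t x)"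
  \<comment> \<open>Regrouping by the times of \<open>X\<close> is what makes \<open>Y\<close>
    Gaussian: the definition speaks of combinations with one coefficient per time.\<close>
  have Y: "Y = (\<lambda>x. \<Sum>s\<in>S. (\<Sum>t\<in>J. a t * b t s) * X s x)"
    unfolding Y_def sum_distrib_right by (subst sum.swap) (simp add: V sum_distrib_left mult.assoc)
  have V2: "gaussian_rv M (V t)" if "t \<in> J" for t
  proof -
    have "V t = (\<lambda>x. \<Sum>s\<in>S. b t s * X s x)" using V that by auto
    then show ?thesis using gX[of "b t"] by simp
  qed
  have I: "integrable M (\<lambda>x. V t x * V t' x)" if "t \<in> J" "t' \<in> J" for t t'
    using that by (intro integrable_mult_square gaussian_rv_square_integrable V2)
  have "expectation (\<lambda>x. (Y x)\<^sup>2) = expectation (\<lambda>x. \<Sum>t\<in>J. \<Sum>t'\<in>J. a t * a t' * (V t x * V t' x))"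
    by (simp add: Y_def power2_eq_square sum_product mult_ac)
  also have "\<dots> = (\<Sum>t\<in>J. \<Sum>t'\<in>J. a t * a t' * R t t')"
    using I by (simp add: Bochner_Integration.integral_sum Bochner_Integration.integrable_sum cov)
  finally have "expectation (\<lambda>x. (Y x)\<^sup>2) = (\<Sum>t\<in>J. \<Sum>t'\<in>J. a t * a t' * R t t')" .
  moreover have "gaussian_rv M Y" "expectation Y = 0"
    unfolding Y by (rule gX mean)+
  ultimately have "(CLINT x|M. iexp (Y x)) = exp (- (\<Sum>t\<in>J. \<Sum>t'\<in>J. a t * a t' * R t t') / 2)"
    by (simp only: gaussian_rv_char)
  then show ?thesis by (simp only: Y_def)
qed

section \<open>Integrals of step functions\<close>

text \<open>Brings the endpoints of a step function into the form in which
  \<open>standard_brownian_motion\<close> states independence of increments: a sequence increasing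
  strictly up to index \<open>n\<close>.\<close>

lemma finite_subset_range_increasing:
  fixes P :: "real set"
  assumes "finite P" "P \<subseteq> {0..}"
  obtains n and t :: "nat \<Rightarrow> real" where "0 \<le> t 0" "\<forall>i<n. t i < t (Suc i)" "P \<subseteq> t ` {..n}"
proof -
  \<comment> \<open>Inserting 0 keeps the list nonempty when \<open>P\<close> is empty. Its last
    index, \<open>length ts - 1\<close>, is the number \<open>n\<close> of cells.\<close>
  define ts where "ts = sorted_list_of_set (insert 0 P)"
  have set: "set ts = insert 0 P" and sorted: "sorted_wrt (<) ts"
    using assms by (simp_all add: ts_def strict_sorted_list_of_set del: sorted_list_of_set_insert_remove)
  then have ne: "length ts > 0" by auto
  show thesis
  proof
    show "0 \<le> ts ! 0" using set assms ne nth_mem[of 0 ts] by auto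
    show "\<forall>i<length ts - 1. ts ! i < ts ! Suc i"
      using sorted_wrt_nth_less[OF sorted] by simp
    have "set ts = (!) ts ` {..length ts - 1}"
      using ne by (simp add: set_conv_nth image_def atMost_def less_Suc_eq_le[symmetric] Bex_def conj_commute)
    then show "P \<subseteq> (!) ts ` {..length ts - 1}" using set by (metis subset_insertI)
  qed
qed

lemma less_of_Suc_less:
  fixes t :: "nat \<Rightarrow> 'a :: order"
  assumes "\<forall>i<n. t i < t (Suc i)" "i < j" "j \<le> n"
  shows "t i < t j"
  using assms(2,3)
proof (induction j)
  case (Suc j)
  then show ?case using assms(1) by (cases "i = j") (auto intro: less_trans)
qed simp

definition endpoints :: "(real \<times> real \<times> real) list \<Rightarrow> real set" where
  "endpoints p = (\<Union>(c, a, b)\<in>set p. {a, b})"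

text \<open>Stated for an arbitrary integrator \<open>W\<close>: for \<open>W b \<theta> = 1\<close> if \<open>\<theta> \<le> b\<close> and \<open>0\<close> otherwise, the
  step integral is the step function itself.\<close>

lemma step_integral_on_partition:
  fixes W :: "real \<Rightarrow> 'a \<Rightarrow> real"
  assumes "valid_step p" "endpoints p \<subseteq> t ` {..n}" and t: "\<forall>i<n. t i < t (Suc i)"
  shows "step_integral W p \<omega> = (\<Sum>i<n. step_fun p (t (Suc i)) * (W (t (Suc i)) \<omega> - W (t i) \<omega>))"
  using assms(1,2)
proof (induction p)
  case Nil
  then show ?case by (simp add: step_integral_def step_fun_def)
next
  case (Cons q p)
  obtain c a b where q: "q = (c, a, b)" by (cases q) auto
  have mono: "t i < t j" if "i < j" "j \<le> n" for i j
    using less_of_Suc_less[of n t] t that by blast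
  obtain j k where j: "a = t j" "j \<le> n" and k: "b = t k" "k \<le> n"
    using Cons.prems q by (auto simp: endpoints_def)
  have jk: "j \<le> k" using Cons.prems(1) mono[of k j] j k q by (force simp: valid_step_def)
  \<comment> \<open>As intervals are open on the left and closed on the right, the right end of a
    cell decides for the whole cell: it lies in \<open>{t j<..t k}\<close> exactly for
    \<open>j \<le> i < k\<close>. The sum over these cells then telescopes.\<close>
  have ind: "indicator {a<..b} (t (Suc i)) = (if i \<in> {j..<k} then 1 else 0 :: real)" if "i < n" for i
    using mono[of j "Suc i"] mono[of "Suc i" j] mono[of "Suc i" k] mono[of k "Suc i"] that j k
    by (cases "Suc i = j"; cases "Suc i = k") (auto simp: indicator_def not_less)
  have "(\<Sum>i<n. indicator {a<..b} (t (Suc i)) * (W (t (Suc i)) \<omega> - W (t i) \<omega>))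
      = (\<Sum>i<n. if i \<in> {j..<k} then W (t (Suc i)) \<omega> - W (t i) \<omega> else 0)"
    by (intro sum.cong) (auto simp: ind)
  also have "\<dots> = (\<Sum>i\<in>{j..<k}. W (t (Suc i)) \<omega> - W (t i) \<omega>)"
    using k by (subst sum.inter_restrict[symmetric]) (auto intro!: sum.cong)
  also have "\<dots> = W b \<omega> - W a \<omega>"
    using sum_Suc_diff'[OF jk, of "\<lambda>i. W (t i) \<omega>"] j k by simp
  finally have "W b \<omega> - W a \<omega> = (\<Sum>i<n. indicator {a<..b} (t (Suc i)) * (W (t (Suc i)) \<omega> - W (t i) \<omega>))" ..
  moreover have "step_integral W p \<omega> = (\<Sum>i<n. step_fun p (t (Suc i)) * (W (t (Suc i)) \<omega> - W (t i) \<omega>))"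
    using Cons by (auto simp: valid_step_def endpoints_def)
  moreover have "step_integral W (q # p) \<omega> = c * (W b \<omega> - W a \<omega>) + step_integral W p \<omega>"
    "step_fun (q # p) \<theta> = c * indicator {a<..b} \<theta> + step_fun p \<theta>" for \<theta>
    by (simp_all add: q step_integral_def step_fun_def)
  ultimately show ?case
    by (simp only: sum_distrib_left sum.distrib distrib_right mult.assoc)
qed

text \<open>Rests on \<open>a \<le> b\<close>: for a reversed interval the difference of the two
  indicators would be negative on it instead of 0.\<close>

lemma step_fun_eq_step_integral:
  assumes "valid_step p"
  shows "step_fun p \<theta> = step_integral (\<lambda>b \<theta>. indicator {..b} \<theta>) p \<theta>"
  using assms unfolding step_fun_def step_integral_def valid_step_def
  by (intro arg_cong[where f=sum_list] map_cong) (auto simp: indicator_def)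

lemma step_fun_on_partition:
  assumes "valid_step p" "endpoints p \<subseteq> t ` {..n}" and t: "\<forall>i<n. t i < t (Suc i)"
  shows "step_fun p \<theta> = (\<Sum>i<n. step_fun p (t (Suc i)) * indicator {t i<..t (Suc i)} \<theta>)"
proof -
  have "step_fun p \<theta> = (\<Sum>i<n. step_fun p (t (Suc i)) * (indicator {..t (Suc i)} \<theta> - indicator {..t i} \<theta>))"
    unfolding step_fun_eq_step_integral[OF assms(1), of \<theta>] by (rule step_integral_on_partition[OF assms])
  also have "\<dots> = (\<Sum>i<n. step_fun p (t (Suc i)) * indicator {t i<..t (Suc i)} \<theta>)"
    using t by (intro sum.cong) (auto simp: indicator_def dest: less_imp_le less_trans)
  finally show ?thesis .
qed

text \<open>Distinct cells are disjoint, so all cross terms of the square vanish. The value is the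
  variance of the step integral, that is, the isometry for step functions.\<close>

lemma has_bochner_integral_step_fun_square:
  assumes p: "valid_step p" "endpoints p \<subseteq> t ` {..n}" and t: "\<forall>i<n. t i < t (Suc i)"
  shows "has_bochner_integral lborel (\<lambda>\<theta>. (step_fun p \<theta>)\<^sup>2) (\<Sum>i<n. (step_fun p (t (Suc i)))\<^sup>2 * (t (Suc i) - t i))"
proof -
  have mono: "t i \<le> t j" if "i \<le> j" "j \<le> n" for i j
    using less_of_Suc_less[of n t i j] t that by (cases "i = j") (auto simp: less_imp_le)
  have disj: "indicator {t i<..t (Suc i)} \<theta> * indicator {t j<..t (Suc j)} \<theta> = (if i = j then indicator {t i<..t (Suc i)} \<theta> else 0 :: real)"
    if "i < n" "j < n" for i j \<theta>
    using mono[of "Suc i" j] mono[of "Suc j" i] that by (auto simp: indicator_def not_le Suc_le_eq neq_iff)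
  have sq: "(step_fun p \<theta>)\<^sup>2 = (\<Sum>i<n. (step_fun p (t (Suc i)))\<^sup>2 * indicator {t i<..t (Suc i)} \<theta>)" for \<theta>
  proof -
    have "(step_fun p \<theta>)\<^sup>2 = (\<Sum>i<n. \<Sum>j<n. step_fun p (t (Suc i)) * step_fun p (t (Suc j)) *
        (indicator {t i<..t (Suc i)} \<theta> * indicator {t j<..t (Suc j)} \<theta>))"
      unfolding power2_eq_square step_fun_on_partition[OF p t, of \<theta>] sum_product by (simp add: mult_ac)
    also have "\<dots> = (\<Sum>i<n. \<Sum>j<n. if i = j then (step_fun p (t (Suc i)))\<^sup>2 * indicator {t i<..t (Suc i)} \<theta> else 0)"
      by (intro sum.cong) (auto simp: disj power2_eq_square)
    finally show ?thesis by simp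
  qed
  have "has_bochner_integral lborel (indicator {t i<..t (Suc i)}) (t (Suc i) - t i)" if "i < n" for i
    using has_bochner_integral_real_indicator[of "{t i<..t (Suc i)}" lborel] that by (simp add: less_imp_le t)
  then have "has_bochner_integral lborel (\<lambda>\<theta>. (step_fun p (t (Suc i)))\<^sup>2 * indicator {t i<..t (Suc i)} \<theta>)
      ((step_fun p (t (Suc i)))\<^sup>2 * (t (Suc i) - t i))" if "i \<in> {..<n}" for i
    using that by (intro has_bochner_integral_mult_right) auto
  then have "has_bochner_integral lborel (\<lambda>\<theta>. \<Sum>i<n. (step_fun p (t (Suc i)))\<^sup>2 * indicator {t i<..t (Suc i)} \<theta>)
      (\<Sum>i<n. (step_fun p (t (Suc i)))\<^sup>2 * (t (Suc i) - t i))"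
    by (rule has_bochner_integral_sum)
  then show ?thesis by (simp only: sq[symmetric])
qed

lemma endpoints_valid: "valid_step p \<Longrightarrow> finite (endpoints p) \<and> endpoints p \<subseteq> {0..}"
  by (induction p) (auto simp: endpoints_def valid_step_def)

lemma integrable_step_fun_square: "valid_step p \<Longrightarrow> integrable lborel (\<lambda>\<theta>. (step_fun p \<theta>)\<^sup>2)"
proof -
  assume p: "valid_step p"
  obtain n t where "0 \<le> t 0" and t: "\<forall>i<n. t i < t (Suc i)" and "endpoints p \<subseteq> t ` {..n}"
    using endpoints_valid[OF p] finite_subset_range_increasing[of "endpoints p"] by metis
  then show "integrable lborel (\<lambda>\<theta>. (step_fun p \<theta>)\<^sup>2)"
    using has_bochner_integral_step_fun_square[OF p, of t n] by (blast intro: integrable.intros)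
qed

lemma step_fun_negative: "valid_step p \<Longrightarrow> \<theta> < 0 \<Longrightarrow> step_fun p \<theta> = 0"
  by (induction p) (auto simp: step_fun_def valid_step_def indicator_def)

lemma step_fun_measurable [measurable]: "step_fun p \<in> borel_measurable borel"
  by (induction p) (auto simp: step_fun_def[abs_def])

lemma step_integral_measurable:
  assumes "standard_brownian_motion M W" "valid_step p"
  shows "step_integral W p \<in> borel_measurable M"
  using assms(2)
proof (induction p)
  case (Cons q p)
  then have "(\<lambda>\<omega>. step_integral W p \<omega>) \<in> borel_measurable M" "W (fst (snd q)) \<in> borel_measurable M" "W (snd (snd q)) \<in> borel_measurable M"
    using assms(1) by (auto simp: valid_step_def standard_brownian_motion_def)
  then show ?case by (auto simp: step_integral_def[abs_def] split_beta)
qed (simp add: step_integral_def[abs_def])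

text \<open>Scaling and concatenating the lists works because intervals may overlap. One list
  \<open>q\<close> thus represents the combination both as a function and as an integral, which
  reduces joint laws to a single step integral.\<close>

lemma step_linear_combination:
  fixes W :: "real \<Rightarrow> 'a \<Rightarrow> real"
  assumes "finite J" "\<And>j. j \<in> J \<Longrightarrow> valid_step (p j)"
  shows "\<exists>q. valid_step q \<and> (\<forall>\<theta>. step_fun q \<theta> = (\<Sum>j\<in>J. a j * step_fun (p j) \<theta>)) \<and>
     (\<forall>\<omega>. step_integral W q \<omega> = (\<Sum>j\<in>J. a j * step_integral W (p j) \<omega>))"
  using assms
proof (induction J)
  case empty
  then show ?case by (intro exI[of _ "[]"]) (auto simp: valid_step_def step_fun_def step_integral_def)
next
  case (insert k J)
  then obtain q where q: "valid_step q" "\<And>\<theta>. step_fun q \<theta> = (\<Sum>j\<in>J. a j * step_fun (p j) \<theta>)"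
    "\<And>\<omega>. step_integral W q \<omega> = (\<Sum>j\<in>J. a j * step_integral W (p j) \<omega>)" by auto
  define r where "r = map (\<lambda>(c, u, v). (a k * c, u, v)) (p k)"
  have "valid_step r" using insert.prems[of k] by (auto simp: r_def valid_step_def)
  moreover have "step_fun r \<theta> = a k * step_fun (p k) \<theta>" for \<theta>
    by (simp add: r_def step_fun_def o_def case_prod_unfold sum_list_const_mult mult.assoc)
  moreover have "step_integral W r \<omega> = a k * step_integral W (p k) \<omega>" for \<omega>
    by (simp add: r_def step_integral_def o_def case_prod_unfold sum_list_const_mult mult.assoc)
  ultimately show ?case using insert.hyps q
    by (intro exI[of _ "r @ q"]) (auto simp: valid_step_def step_fun_def step_integral_def)
qed

lemma (in prob_space) step_integral_char:
  assumes W: "standard_brownian_motion M W" and p: "valid_step p"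
  shows "(CLINT x|M. iexp (step_integral W p x)) = exp (- (LINT \<theta>|lborel. (step_fun p \<theta>)\<^sup>2) / 2)"
proof -
  obtain n t where t0: "0 \<le> t 0" and t: "\<forall>i<n. t i < t (Suc i)" and pt: "endpoints p \<subseteq> t ` {..n}"
    using endpoints_valid[OF p] finite_subset_range_increasing[of "endpoints p"] by metis
  have mono: "t 0 \<le> t j" if "j \<le> n" for j
    using less_of_Suc_less[of n t 0 j] t that by (cases "j = 0") (auto simp: less_imp_le)
  define d where "d i = step_fun p (t (Suc i))" for i
  define \<Delta> where "\<Delta> i \<omega> = W (t (Suc i)) \<omega> - W (t i) \<omega>" for i \<omega>
  have "indep_vars (\<lambda>_. borel) \<Delta> {..<n}"
    using W t0 t unfolding standard_brownian_motion_def \<Delta>_def by simp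
  then have ind: "indep_vars (\<lambda>_. borel) (\<lambda>i x. d i * \<Delta> i x) {..<n}"
    by (rule indep_vars_compose2[where Y="\<lambda>i x. d i * x"]) auto
  have step: "step_integral W p x = (\<Sum>i<n. d i * \<Delta> i x)" for x
    using step_integral_on_partition[OF p pt t] by (simp add: d_def \<Delta>_def)
  have meas: "(\<lambda>x. d i * \<Delta> i x) \<in> borel_measurable M" if "i \<in> {..<n}" for i
    using ind that by (auto simp: indep_vars_def)
  then have [measurable]: "(\<lambda>x. \<Sum>i<n. d i * \<Delta> i x) \<in> borel_measurable M" by auto
  have D: "distributed M lborel (\<Delta> i) (normal_density 0 (sqrt (t (Suc i) - t i)))" if "i < n" for i
    using W t that mono[of i] t0 that unfolding standard_brownian_motion_def \<Delta>_def[abs_def] by auto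
  have "(CLINT x|M. iexp (step_integral W p x)) = char (distr M borel (\<lambda>x. \<Sum>i<n. d i * \<Delta> i x)) 1"
    by (simp add: char_def integral_distr step)
  also have "\<dots> = (\<Prod>i<n. char (distr M borel (\<lambda>x. d i * \<Delta> i x)) 1)"
    by (rule char_distr_sum[OF ind])
  also have "\<dots> = (\<Prod>i<n. CLINT x|M. iexp (d i * \<Delta> i x))"
    using meas by (intro prod.cong) (simp_all add: char_def integral_distr del: of_real_mult)
  also have "\<dots> = (\<Prod>i<n. complex_of_real (exp (- ((t (Suc i) - t i) * (d i)\<^sup>2 / 2))))"
    using t by (intro prod.cong refl, subst char_normal[OF _ D]) (auto simp: less_imp_le)
  also have "\<dots> = exp (- (\<Sum>i<n. (d i)\<^sup>2 * (t (Suc i) - t i)) / 2)"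
    by (simp add: exp_sum[symmetric] sum_negf sum_divide_distrib mult.commute flip: of_real_prod)
  \<comment> \<open>Written as a squared L2 norm, the exponent no longer depends on the partition
    and can pass to the limit.\<close>
  also have "(\<Sum>i<n. (d i)\<^sup>2 * (t (Suc i) - t i)) = (LINT \<theta>|lborel. (step_fun p \<theta>)\<^sup>2)"
    using has_bochner_integral_step_fun_square[OF p pt t] by (simp add: d_def has_bochner_integral_integral_eq)
  finally show ?thesis .
qed

section \<open>The covariance integral\<close>

text \<open>Substituting \<open>x = u * \<theta>\<close> in the Euler integral for
  \<open>Gamma (1 - K)\<close> produces the factor \<open>u * u powr (- K)\<close>, which is then
  moved across by multiplying with its inverse.\<close>

lemma nn_integral_powr_exp:
  fixes K u :: real
  assumes "K < 1" "0 < u"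
  shows "(\<integral>\<^sup>+\<theta>. ennreal (indicator {0..} \<theta> * (\<theta> powr (- K) * exp (- \<theta> * u))) \<partial>lborel)
     = ennreal (Gamma (1 - K) * u powr (K - 1))"
proof -
  let ?I = "\<integral>\<^sup>+\<theta>. ennreal (indicator {0..} \<theta> * (\<theta> powr (- K) * exp (- \<theta> * u))) \<partial>lborel"
  have "ennreal (Gamma (1 - K)) = (\<integral>\<^sup>+x. ennreal (indicator {0..} x * x powr (- K) / exp x) \<partial>lborel)"
    using Gamma_conv_nn_integral_real[of "1 - K"] assms by simp
  also have "\<dots> = ennreal u * (\<integral>\<^sup>+\<theta>. ennreal (indicator {0..} (u * \<theta>) * (u * \<theta>) powr (- K) / exp (u * \<theta>)) \<partial>lborel)"
    using assms by (subst nn_integral_real_affine[where t=0 and c=u]) auto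
  also have "(\<integral>\<^sup>+\<theta>. ennreal (indicator {0..} (u * \<theta>) * (u * \<theta>) powr (- K) / exp (u * \<theta>)) \<partial>lborel)
     = (\<integral>\<^sup>+\<theta>. ennreal (u powr (- K)) * ennreal (indicator {0..} \<theta> * (\<theta> powr (- K) * exp (- \<theta> * u))) \<partial>lborel)"
    using assms by (intro nn_integral_cong)
      (auto simp: indicator_def powr_mult exp_minus field_simps zero_le_mult_iff ennreal_mult'[symmetric])
  also have "\<dots> = ennreal (u powr (- K)) * ?I"
    by (intro nn_integral_cmult) auto
  finally have *: "ennreal (Gamma (1 - K)) = ennreal (u powr (1 - K)) * ?I"
    using assms by (simp add: mult.assoc[symmetric] ennreal_mult'[symmetric] powr_diff powr_minus_divide)
  have "ennreal (u powr (K - 1)) * ennreal (u powr (1 - K)) = 1"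
    using assms by (simp add: ennreal_mult'[symmetric] powr_add[symmetric])
  then have "?I = ennreal (u powr (K - 1)) * ennreal (Gamma (1 - K))"
    unfolding * by (simp add: mult.assoc[symmetric])
  then show ?thesis using assms by (simp add: ennreal_mult'[symmetric] mult.commute)
qed

text \<open>Tonelli applied to \<open>(1 - exp (-\<theta>t)) / \<theta> = \<integral>\<^sub>0\<^sup>t exp (-\<theta>u) du\<close>.\<close>

lemma has_bochner_integral_one_minus_exp_powr:
  fixes K t :: real
  assumes K: "0 < K" "K < 1" and t: "0 \<le> t"
  shows "has_bochner_integral lborel (\<lambda>\<theta>. indicator {0..} \<theta> * ((1 - exp (- \<theta> * t)) * \<theta> powr (- 1 - K)))
    (Gamma (1 - K) / K * t powr K)"
proof (rule has_bochner_integral_nn_integral)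
  show "AE \<theta> in lborel. 0 \<le> indicator {0..} \<theta> * ((1 - exp (- \<theta> * t)) * \<theta> powr (- 1 - K))"
    using t by (auto simp: indicator_def)
  show "0 \<le> Gamma (1 - K) / K * t powr K" using K by simp
  have "(\<integral>\<^sup>+\<theta>. ennreal (indicator {0..} \<theta> * ((1 - exp (- \<theta> * t)) * \<theta> powr (- 1 - K))) \<partial>lborel)
     = (\<integral>\<^sup>+\<theta>. \<integral>\<^sup>+u. ennreal (indicator {0..t} u * (indicator {0..} \<theta> * (\<theta> powr (- K) * exp (- \<theta> * u)))) \<partial>lborel \<partial>lborel)"
  proof (rule nn_integral_cong)
    fix \<theta> :: real
    show "ennreal (indicator {0..} \<theta> * ((1 - exp (- \<theta> * t)) * \<theta> powr (- 1 - K)))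
       = (\<integral>\<^sup>+u. ennreal (indicator {0..t} u * (indicator {0..} \<theta> * (\<theta> powr (- K) * exp (- \<theta> * u)))) \<partial>lborel)"
    proof (cases "\<theta> > 0")
      case True
      have "((\<lambda>u. \<theta> powr (- K) * exp (- \<theta> * u)) has_integral
         (- (\<theta> powr (- K) / \<theta>) * exp (- \<theta> * t) - - (\<theta> powr (- K) / \<theta>) * exp (- \<theta> * 0))) {0..t}"
        using True t by (intro fundamental_theorem_of_calculus)
          (auto intro!: derivative_eq_intros simp flip: has_real_derivative_iff_has_vector_derivative)
      then have I: "(\<integral>\<^sup>+u. ennreal (indicator {0..t} u * (\<theta> powr (- K) * exp (- \<theta> * u))) \<partial>lborel)
         = ennreal (- (\<theta> powr (- K) / \<theta>) * exp (- \<theta> * t) - - (\<theta> powr (- K) / \<theta>) * exp (- \<theta> * 0))"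
        by (intro nn_integral_has_integral_lebesgue) auto
      have *: "\<theta> powr (- 1 - K) = \<theta> powr (- K) / \<theta>"
        using True by (simp add: powr_diff powr_minus_divide)
      have "(1 - exp (- \<theta> * t)) * \<theta> powr (- 1 - K)
         = - (\<theta> powr (- K) / \<theta>) * exp (- \<theta> * t) - - (\<theta> powr (- K) / \<theta>) * exp (- \<theta> * 0)"
        unfolding * by (simp add: algebra_simps diff_divide_distrib)
      with I have "ennreal ((1 - exp (- \<theta> * t)) * \<theta> powr (- 1 - K))
         = (\<integral>\<^sup>+u. ennreal (indicator {0..t} u * (\<theta> powr (- K) * exp (- \<theta> * u))) \<partial>lborel)"
        by (simp only:)
      then show ?thesis using True by simp
    next
      \<comment> \<open>At \<open>\<theta> = 0\<close> both sides vanish because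
        \<open>0 powr x = 0\<close>; for negative \<open>\<theta>\<close> the indicator is
        0.\<close>
      case False
      then show ?thesis by (cases "\<theta> = 0") auto
    qed
  qed
  also have "\<dots> = (\<integral>\<^sup>+u. \<integral>\<^sup>+\<theta>. ennreal (indicator {0..t} u * (indicator {0..} \<theta> * (\<theta> powr (- K) * exp (- \<theta> * u)))) \<partial>lborel \<partial>lborel)"
    by (rule lborel_pair.Fubini') (auto simp: case_prod_unfold indicator_def cong: measurable_cong_sets)
  also have "\<dots> = (\<integral>\<^sup>+u. ennreal (indicator {0..t} u * (Gamma (1 - K) * u powr (K - 1))) \<partial>lborel)"
  \<comment> \<open>The point \<open>u = 0\<close> has to be excluded: there the inner integral
    diverges, while \<open>0 powr (K - 1)\<close> is 0.\<close>
  proof (rule nn_integral_cong_AE, use AE_lborel_singleton[of 0] in eventually_elim)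
    fix u :: real assume "u \<noteq> 0"
    then show "(\<integral>\<^sup>+\<theta>. ennreal (indicator {0..t} u * (indicator {0..} \<theta> * (\<theta> powr (- K) * exp (- \<theta> * u)))) \<partial>lborel)
       = ennreal (indicator {0..t} u * (Gamma (1 - K) * u powr (K - 1)))"
      using nn_integral_powr_exp[OF K(2), of u] by (cases "u \<in> {0..t}") auto
  qed
  also have "\<dots> = ennreal (Gamma (1 - K) * (t powr (K - 1 + 1) / (K - 1 + 1)))"
    using K t by (intro nn_integral_has_integral_lebesgue has_integral_mult_right has_integral_powr_from_0) auto
  finally show "(\<integral>\<^sup>+\<theta>. ennreal (indicator {0..} \<theta> * ((1 - exp (- \<theta> * t)) * \<theta> powr (- 1 - K))) \<partial>lborel)
     = ennreal (Gamma (1 - K) / K * t powr K)" by simp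
qed measurable

text \<open>The two powers combine to \<open>\<theta> powr (- 1 - K)\<close>. Against this weight a
  single exponential is not integrable at 0, so the product is split into terms of the form
  \<open>1 - exp\<close>, each of which is.\<close>

lemma has_bochner_integral_kernel_product:
  fixes K t s :: real
  assumes K: "0 < K" "K < 1" and t: "0 \<le> t" and s: "0 \<le> s"
  shows "has_bochner_integral lborel
    (\<lambda>\<theta>. (indicator {0..} \<theta> * ((1 - exp (- \<theta> * t)) * \<theta> powr (- (1 + K) / 2))) *
          (indicator {0..} \<theta> * ((1 - exp (- \<theta> * s)) * \<theta> powr (- (1 + K) / 2))))
    (Gamma (1 - K) / K * (t powr K + s powr K - (t + s) powr K))"
proof -
  note h = has_bochner_integral_one_minus_exp_powr[OF K]
  have "has_bochner_integral lborel
    (\<lambda>\<theta>. indicator {0..} \<theta> * ((1 - exp (- \<theta> * t)) * \<theta> powr (- 1 - K))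
        + indicator {0..} \<theta> * ((1 - exp (- \<theta> * s)) * \<theta> powr (- 1 - K))
        - indicator {0..} \<theta> * ((1 - exp (- \<theta> * (t + s))) * \<theta> powr (- 1 - K)))
    (Gamma (1 - K) / K * t powr K + Gamma (1 - K) / K * s powr K - Gamma (1 - K) / K * (t + s) powr K)"
    using t s by (intro has_bochner_integral_diff has_bochner_integral_add h) auto
  moreover have "indicator {0..} \<theta> * ((1 - exp (- \<theta> * t)) * \<theta> powr (- 1 - K))
        + indicator {0..} \<theta> * ((1 - exp (- \<theta> * s)) * \<theta> powr (- 1 - K))
        - indicator {0..} \<theta> * ((1 - exp (- \<theta> * (t + s))) * \<theta> powr (- 1 - K))
      = (indicator {0..} \<theta> * ((1 - exp (- \<theta> * t)) * \<theta> powr (- (1 + K) / 2))) *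
          (indicator {0..} \<theta> * ((1 - exp (- \<theta> * s)) * \<theta> powr (- (1 + K) / 2)))" for \<theta> :: real
  proof -
    have "\<theta> powr (- 1 - K) = \<theta> powr (- (1 + K) / 2) * \<theta> powr (- (1 + K) / 2)"
      unfolding powr_add[symmetric] by (rule arg_cong[where f="(powr) \<theta>"]) (simp add: field_simps)
    moreover have "exp (- \<theta> * (t + s)) = exp (- \<theta> * t) * exp (- \<theta> * s)"
      by (simp add: exp_add[symmetric] algebra_simps)
    ultimately show ?thesis by (simp only:) (simp add: indicator_def algebra_simps)
  qed
  ultimately show ?thesis by (simp only: right_diff_distrib distrib_left)
qed

section \<open>Convergence in the second mean\<close>

text \<open>Cauchy-Schwarz in the coefficients gives a bound whose constant, the sum of the squares
  of \<open>a\<close>, is the same for all \<open>n\<close> and \<open>x\<close>. Used on the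
  probability space and on the line.\<close>

lemma L2_convergence_linear_combination:
  fixes d :: "'i \<Rightarrow> nat \<Rightarrow> 'a \<Rightarrow> real"
  assumes J: "finite J" and [measurable]: "\<And>t n. t \<in> J \<Longrightarrow> d t n \<in> borel_measurable M"
    and lim: "\<And>t. t \<in> J \<Longrightarrow> (\<lambda>n. \<integral>\<^sup>+x. ennreal ((d t n x)\<^sup>2) \<partial>M) \<longlonglongrightarrow> 0"
  shows "(\<lambda>n. \<integral>\<^sup>+x. ennreal ((\<Sum>t\<in>J. a t * d t n x)\<^sup>2) \<partial>M) \<longlonglongrightarrow> 0"
proof (rule tendsto_sandwich[OF _ _ tendsto_const])
  let ?c = "\<Sum>t\<in>J. (a t)\<^sup>2"
  have "(\<integral>\<^sup>+x. ennreal ((\<Sum>t\<in>J. a t * d t n x)\<^sup>2) \<partial>M) \<le> ennreal ?c * (\<Sum>t\<in>J. \<integral>\<^sup>+x. ennreal ((d t n x)\<^sup>2) \<partial>M)" for n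
  proof -
    have "(\<integral>\<^sup>+x. ennreal ((\<Sum>t\<in>J. a t * d t n x)\<^sup>2) \<partial>M) \<le> (\<integral>\<^sup>+x. ennreal ?c * (\<Sum>t\<in>J. ennreal ((d t n x)\<^sup>2)) \<partial>M)"
    proof (rule nn_integral_mono)
      fix x
      have "(\<Sum>t\<in>J. a t * d t n x)\<^sup>2 \<le> ?c * (\<Sum>t\<in>J. (d t n x)\<^sup>2)"
        by (rule Cauchy_Schwarz_ineq_sum)
      then show "ennreal ((\<Sum>t\<in>J. a t * d t n x)\<^sup>2) \<le> ennreal ?c * (\<Sum>t\<in>J. ennreal ((d t n x)\<^sup>2))"
        by (simp add: sum_ennreal ennreal_mult''[symmetric] sum_nonneg ennreal_leI)
    qed
    also have "\<dots> = ennreal ?c * (\<Sum>t\<in>J. \<integral>\<^sup>+x. ennreal ((d t n x)\<^sup>2) \<partial>M)"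
      by (subst nn_integral_cmult, measurable) (subst nn_integral_sum, auto)
    finally show ?thesis .
  qed
  then show "\<forall>\<^sub>F n in sequentially. (\<integral>\<^sup>+x. ennreal ((\<Sum>t\<in>J. a t * d t n x)\<^sup>2) \<partial>M)
      \<le> ennreal ?c * (\<Sum>t\<in>J. \<integral>\<^sup>+x. ennreal ((d t n x)\<^sup>2) \<partial>M)" by simp
  have "(\<lambda>n. ennreal ?c * (\<Sum>t\<in>J. \<integral>\<^sup>+x. ennreal ((d t n x)\<^sup>2) \<partial>M)) \<longlonglongrightarrow> ennreal ?c * (\<Sum>t\<in>J. 0)"
    by (intro ennreal_tendsto_cmult tendsto_sum lim) auto
  then show "(\<lambda>n. ennreal ?c * (\<Sum>t\<in>J. \<integral>\<^sup>+x. ennreal ((d t n x)\<^sup>2) \<partial>M)) \<longlonglongrightarrow> 0" by simp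
qed simp

lemma L2_convergence_norm:
  fixes g :: "'a \<Rightarrow> real"
  assumes [measurable]: "\<And>n. s n \<in> borel_measurable M" "g \<in> borel_measurable M"
    and s: "\<And>n. integrable M (\<lambda>x. (s n x)\<^sup>2)" and g: "integrable M (\<lambda>x. (g x)\<^sup>2)"
    and lim: "(\<lambda>n. \<integral>\<^sup>+x. ennreal ((s n x - g x)\<^sup>2) \<partial>M) \<longlonglongrightarrow> 0"
  shows "(\<lambda>n. LINT x|M. (s n x)\<^sup>2) \<longlonglongrightarrow> (LINT x|M. (g x)\<^sup>2)"
proof -
  define e where "e n = (LINT x|M. (s n x - g x)\<^sup>2)" for n
  let ?G = "LINT x|M. (g x)\<^sup>2"
  have d: "integrable M (\<lambda>x. (s n x - g x)\<^sup>2)" for n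
  proof (rule Bochner_Integration.integrable_bound)
    show "integrable M (\<lambda>x. 2 * (s n x)\<^sup>2 + 2 * (g x)\<^sup>2)" using s g by simp
    have "(u - v)\<^sup>2 \<le> 2 * u\<^sup>2 + 2 * v\<^sup>2" for u v :: real
      using zero_le_power2[of "u + v"] by (simp add: power2_eq_square algebra_simps)
    then show "AE x in M. norm ((s n x - g x)\<^sup>2) \<le> norm (2 * (s n x)\<^sup>2 + 2 * (g x)\<^sup>2)" by simp
  qed measurable
  have "(\<integral>\<^sup>+x. ennreal ((s n x - g x)\<^sup>2) \<partial>M) = ennreal (e n)" for n
    unfolding e_def by (rule nn_integral_eq_integral[OF d]) simp
  then have "(\<lambda>n. ennreal (e n)) \<longlonglongrightarrow> ennreal 0" using lim by simp
  moreover have e0: "e n \<ge> 0" for n by (simp add: e_def)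
  ultimately have e: "e \<longlonglongrightarrow> 0" by (subst (asm) tendsto_ennreal_iff) auto
  \<comment> \<open>The error will be of size \<open>\<epsilon> n * ?G + e n / \<epsilon> n\<close>,
    and \<open>\<epsilon> n\<close> near \<open>sqrt (e n)\<close> sends both terms to 0. The extra
    \<open>1 / real (Suc n)\<close> keeps it positive when \<open>e n = 0\<close>.\<close>
  define \<epsilon> where "\<epsilon> n = sqrt (e n) + 1 / real (Suc n)" for n
  have \<epsilon>0: "\<epsilon> n > 0" for n using e0[of n] by (simp add: \<epsilon>_def add_nonneg_pos)
  have bound: "\<bar>(LINT x|M. (s n x)\<^sup>2) - ?G\<bar> \<le> e n + \<epsilon> n * ?G + sqrt (e n)" for n
  proof -
    have pt: "\<bar>u\<^sup>2 - v\<^sup>2\<bar> \<le> (u - v)\<^sup>2 + (\<epsilon> n * v\<^sup>2 + (u - v)\<^sup>2 / \<epsilon> n)" for u v :: real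
    proof -
      \<comment> \<open>Young's inequality with weight \<open>\<epsilon> n\<close>, for the cross
        term \<open>2 * (\<bar>v\<bar> * \<bar>u - v\<bar>)\<close>.\<close>
      have "0 \<le> (\<epsilon> n * \<bar>v\<bar> - \<bar>u - v\<bar>)\<^sup>2 / \<epsilon> n" using \<epsilon>0[of n] by simp
      also have "\<dots> = \<epsilon> n * v\<^sup>2 + (u - v)\<^sup>2 / \<epsilon> n - 2 * (\<bar>v\<bar> * \<bar>u - v\<bar>)"
        using \<epsilon>0[of n] by (simp add: power2_diff power_mult_distrib field_simps) (simp add: power2_eq_square)
      finally have "2 * (\<bar>v\<bar> * \<bar>u - v\<bar>) \<le> \<epsilon> n * v\<^sup>2 + (u - v)\<^sup>2 / \<epsilon> n" by simp
      moreover have "u\<^sup>2 - v\<^sup>2 = (u - v)\<^sup>2 + 2 * (v * (u - v))" by (simp add: power2_eq_square algebra_simps)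
      then have "\<bar>u\<^sup>2 - v\<^sup>2\<bar> \<le> (u - v)\<^sup>2 + 2 * (\<bar>v\<bar> * \<bar>u - v\<bar>)"
        using abs_triangle_ineq[of "(u - v)\<^sup>2" "2 * (v * (u - v))"] by (simp add: abs_mult)
      ultimately show ?thesis by linarith
    qed
    have "\<bar>(LINT x|M. (s n x)\<^sup>2) - ?G\<bar> = \<bar>LINT x|M. (s n x)\<^sup>2 - (g x)\<^sup>2\<bar>"
      using s g by simp
    also have "\<dots> \<le> (LINT x|M. \<bar>(s n x)\<^sup>2 - (g x)\<^sup>2\<bar>)" by (rule integral_abs_bound)
    also have "\<dots> \<le> (LINT x|M. (s n x - g x)\<^sup>2 + (\<epsilon> n * (g x)\<^sup>2 + (s n x - g x)\<^sup>2 / \<epsilon> n))"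
      using s g d pt by (intro integral_mono) auto
    also have "\<dots> = e n + \<epsilon> n * ?G + e n / \<epsilon> n"
      using d g by (simp add: e_def)
    also have "e n / \<epsilon> n \<le> sqrt (e n)"
    proof -
      have "e n = sqrt (e n) * sqrt (e n)" using e0 by simp
      also have "\<dots> \<le> sqrt (e n) * \<epsilon> n" using e0[of n] by (intro mult_left_mono) (auto simp: \<epsilon>_def)
      finally show ?thesis using \<epsilon>0[of n] by (simp add: pos_divide_le_eq)
    qed
    finally show ?thesis by simp
  qed
  have "\<epsilon> \<longlonglongrightarrow> sqrt 0 + 0"
    unfolding \<epsilon>_def by (intro tendsto_intros e LIMSEQ_Suc[OF lim_1_over_n])
  then have "(\<lambda>n. e n + \<epsilon> n * ?G + sqrt (e n)) \<longlonglongrightarrow> 0 + 0 * ?G + sqrt 0"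
    by (intro tendsto_intros e) simp
  then have "(\<lambda>n. e n + \<epsilon> n * ?G + sqrt (e n)) \<longlonglongrightarrow> 0" by simp
  moreover have "\<forall>\<^sub>F n in sequentially. norm ((LINT x|M. (s n x)\<^sup>2) - ?G) \<le> e n + \<epsilon> n * ?G + sqrt (e n)"
    using bound by simp
  ultimately have "(\<lambda>n. (LINT x|M. (s n x)\<^sup>2) - ?G) \<longlonglongrightarrow> 0"
    by (rule Lim_null_comparison[rotated])
  then show ?thesis by (simp add: LIM_zero_iff)
qed

lemma norm_iexp_diff_le: "norm (iexp x - iexp y) \<le> \<bar>x - y\<bar>"
proof -
  have "iexp x - iexp y = iexp y * (iexp (x - y) - 1)"
    by (simp add: right_diff_distrib mult_exp_exp algebra_simps)
  then show ?thesis using iexp_approx1[of "x - y" 0] by (simp add: norm_mult)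
qed

text \<open>\<open>iexp\<close> is 1-Lipschitz, so \<open>h n\<close> is dominated by the distance
  of \<open>S n\<close> and \<open>Y\<close>. Being bounded by 2 it is integrable for every
  \<open>n\<close>, whereas the L2 distance may be infinite for some \<open>n\<close>.\<close>

lemma (in prob_space) L2_convergence_char:
  assumes [measurable]: "\<And>n. S n \<in> borel_measurable M" "Y \<in> borel_measurable M"
    and lim: "(\<lambda>n. \<integral>\<^sup>+x. ennreal ((S n x - Y x)\<^sup>2) \<partial>M) \<longlonglongrightarrow> 0"
  shows "(\<lambda>n. CLINT x|M. iexp (S n x)) \<longlonglongrightarrow> (CLINT x|M. iexp (Y x))"
proof -
  define h where "h n x = norm (iexp (S n x) - iexp (Y x))" for n x
  have [measurable]: "h n \<in> borel_measurable M" for n unfolding h_def by measurable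
  have h2: "\<bar>h n x\<bar> \<le> 2" for n x
    using norm_triangle_ineq4[of "iexp (S n x)" "iexp (Y x)"] by (simp add: h_def)
  then have hsq: "(h n x)\<^sup>2 \<le> 4" for n x
    using power_mono[of "\<bar>h n x\<bar>" 2 2] h2[of n x] by simp
  have ih: "integrable M (h n)" for n
    using h2 by (intro integrable_const_bound[where B=2]) auto
  have ih2: "integrable M (\<lambda>x. (h n x)\<^sup>2)" for n
    using hsq by (intro integrable_const_bound[where B=4]) auto
  have "ennreal (expectation (\<lambda>x. (h n x)\<^sup>2)) \<le> (\<integral>\<^sup>+x. ennreal ((S n x - Y x)\<^sup>2) \<partial>M)" for n
  proof -
    have "ennreal (expectation (\<lambda>x. (h n x)\<^sup>2)) = (\<integral>\<^sup>+x. ennreal ((h n x)\<^sup>2) \<partial>M)"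
      by (rule nn_integral_eq_integral[symmetric, OF ih2]) simp
    also have "\<dots> \<le> (\<integral>\<^sup>+x. ennreal ((S n x - Y x)\<^sup>2) \<partial>M)"
      by (intro nn_integral_mono ennreal_leI) (simp add: abs_le_square_iff[symmetric] h_def norm_iexp_diff_le)
    finally show ?thesis .
  qed
  then have "(\<lambda>n. ennreal (expectation (\<lambda>x. (h n x)\<^sup>2))) \<longlonglongrightarrow> 0"
    by (intro tendsto_sandwich[OF _ _ tendsto_const lim]) simp_all
  then have "(\<lambda>n. expectation (\<lambda>x. (h n x)\<^sup>2)) \<longlonglongrightarrow> 0"
    using tendsto_ennreal_iff[of "\<lambda>n. expectation (\<lambda>x. (h n x)\<^sup>2)" sequentially 0] by simp
  then have "(\<lambda>n. sqrt (expectation (\<lambda>x. (h n x)\<^sup>2))) \<longlonglongrightarrow> sqrt 0" by (rule tendsto_real_sqrt)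
  moreover have "norm ((CLINT x|M. iexp (S n x)) - (CLINT x|M. iexp (Y x))) \<le> sqrt (expectation (\<lambda>x. (h n x)\<^sup>2))" for n
  proof -
    have i: "integrable M (\<lambda>x. iexp (S n x))" "integrable M (\<lambda>x. iexp (Y x))"
      by (intro integrable_const_bound[where B=1]; simp)+
    have "norm ((CLINT x|M. iexp (S n x)) - (CLINT x|M. iexp (Y x))) = norm (CLINT x|M. iexp (S n x) - iexp (Y x))"
      using i by simp
    also have "\<dots> \<le> expectation (h n)" unfolding h_def by (rule integral_norm_bound)
    also have "\<dots> \<le> sqrt (expectation (\<lambda>x. (h n x)\<^sup>2))"
    proof (rule real_le_rsqrt)
      \<comment> \<open>Nonnegativity of the variance of \<open>h n\<close>.\<close>
      show "(expectation (h n))\<^sup>2 \<le> expectation (\<lambda>x. (h n x)\<^sup>2)"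
        using variance_positive[of "h n"] variance_eq[OF ih ih2] by simp
    qed
    finally show ?thesis .
  qed
  then have "\<forall>\<^sub>F n in sequentially. norm ((CLINT x|M. iexp (S n x)) - (CLINT x|M. iexp (Y x))) \<le> sqrt (expectation (\<lambda>x. (h n x)\<^sup>2))"
    by simp
  ultimately have "(\<lambda>n. (CLINT x|M. iexp (S n x)) - (CLINT x|M. iexp (Y x))) \<longlonglongrightarrow> 0"
    unfolding real_sqrt_zero by (rule Lim_null_comparison[rotated])
  then show ?thesis by (simp add: LIM_zero_iff)
qed

section \<open>Finite dimensional distributions\<close>

lemma square_sum_mult:
  fixes f :: "'i \<Rightarrow> real"
  shows "(\<Sum>t\<in>J. a t * f t)\<^sup>2 = (\<Sum>t\<in>J. \<Sum>s\<in>J. a t * a s * (f t * f s))"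
  by (simp add: power2_eq_square sum_product mult_ac)

text \<open>Both sides of \<open>step_integral_char\<close> converge along the merged step functions
  \<open>q n\<close>: the left by L2 convergence on \<open>M\<close>, the right by convergence of L2
  norms on the line. Uniqueness of limits gives the formula.\<close>

lemma (in prob_space) wiener_integrals_char:
  assumes W: "standard_brownian_motion M W" and J: "finite J"
    and X: "\<And>t. t \<in> J \<Longrightarrow> has_wiener_integral M W (f t) (X t)"
    and f2: "\<And>t. t \<in> J \<Longrightarrow> integrable lborel (\<lambda>\<theta>. (indicator {0..} \<theta> * f t \<theta>)\<^sup>2)"
  shows "(CLINT x|M. iexp (\<Sum>t\<in>J. a t * X t x))
     = exp (- (LINT \<theta>|lborel. (\<Sum>t\<in>J. a t * (indicator {0..} \<theta> * f t \<theta>))\<^sup>2) / 2)"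
proof -
  define g where "g t \<theta> = indicator {0..} \<theta> * f t \<theta>" for t \<theta>
  have [measurable]: "f t \<in> borel_measurable borel" "X t \<in> borel_measurable M" if "t \<in> J" for t
    using X[OF that] by (auto simp: has_wiener_integral_def)
  have [measurable]: "g t \<in> borel_measurable borel" if "t \<in> J" for t
    using that unfolding g_def by measurable
  have "\<forall>t\<in>J. \<exists>p. (\<forall>n::nat. valid_step (p n)) \<and>
        (\<lambda>n. \<integral>\<^sup>+\<theta>\<in>{0..}. ennreal ((step_fun (p n) \<theta> - f t \<theta>)\<^sup>2) \<partial>lborel) \<longlonglongrightarrow> 0 \<and>
        (\<lambda>n. \<integral>\<^sup>+\<omega>. ennreal ((step_integral W (p n) \<omega> - X t \<omega>)\<^sup>2) \<partial>M) \<longlonglongrightarrow> 0"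
    using X by (auto simp: has_wiener_integral_def)
  then obtain p where p: "\<And>t n. t \<in> J \<Longrightarrow> valid_step (p t n)"
    and pf: "\<And>t. t \<in> J \<Longrightarrow> (\<lambda>n. \<integral>\<^sup>+\<theta>\<in>{0..}. ennreal ((step_fun (p t n) \<theta> - f t \<theta>)\<^sup>2) \<partial>lborel) \<longlonglongrightarrow> 0"
    and pX: "\<And>t. t \<in> J \<Longrightarrow> (\<lambda>n. \<integral>\<^sup>+\<omega>. ennreal ((step_integral W (p t n) \<omega> - X t \<omega>)\<^sup>2) \<partial>M) \<longlonglongrightarrow> 0"
    unfolding bchoice_iff by blast
  have "\<exists>q. valid_step q \<and> (\<forall>\<theta>. step_fun q \<theta> = (\<Sum>t\<in>J. a t * step_fun (p t n) \<theta>)) \<and>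
     (\<forall>\<omega>. step_integral W q \<omega> = (\<Sum>t\<in>J. a t * step_integral W (p t n) \<omega>))" for n
    by (rule step_linear_combination[OF J]) (rule p)
  then obtain q where q: "\<And>n. valid_step (q n)"
    and qf: "\<And>n \<theta>. step_fun (q n) \<theta> = (\<Sum>t\<in>J. a t * step_fun (p t n) \<theta>)"
    and qX: "\<And>n \<omega>. step_integral W (q n) \<omega> = (\<Sum>t\<in>J. a t * step_integral W (p t n) \<omega>)"
    by metis
  note [measurable] = step_integral_measurable[OF W]
  have pg: "(\<lambda>n. \<integral>\<^sup>+\<theta>. ennreal ((step_fun (p t n) \<theta> - g t \<theta>)\<^sup>2) \<partial>lborel) \<longlonglongrightarrow> 0" if "t \<in> J" for t
  proof -
    \<comment> \<open>Step functions and \<open>g t\<close> both vanish on the negative axis, so the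
      integral over \<open>{0..}\<close> is one over the whole line.\<close>
    have "ennreal ((step_fun (p t n) \<theta> - f t \<theta>)\<^sup>2) * indicator {0..} \<theta> = ennreal ((step_fun (p t n) \<theta> - g t \<theta>)\<^sup>2)" for n \<theta>
      using step_fun_negative[OF p[OF that], of \<theta> n] by (cases "\<theta> < 0") (auto simp: g_def)
    then show ?thesis using pf[OF that] by simp
  qed
  have "(\<lambda>n. \<integral>\<^sup>+x. ennreal ((\<Sum>t\<in>J. a t * (step_integral W (p t n) x - X t x))\<^sup>2) \<partial>M) \<longlonglongrightarrow> 0"
    by (rule L2_convergence_linear_combination[OF J _ pX]) (use p in measurable)
  then have limX: "(\<lambda>n. \<integral>\<^sup>+x. ennreal ((step_integral W (q n) x - (\<Sum>t\<in>J. a t * X t x))\<^sup>2) \<partial>M) \<longlonglongrightarrow> 0"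
    by (simp add: qX right_diff_distrib sum_subtractf)
  have "(\<lambda>n. \<integral>\<^sup>+\<theta>. ennreal ((\<Sum>t\<in>J. a t * (step_fun (p t n) \<theta> - g t \<theta>))\<^sup>2) \<partial>lborel) \<longlonglongrightarrow> 0"
    by (rule L2_convergence_linear_combination[OF J _ pg]) measurable
  then have limf: "(\<lambda>n. \<integral>\<^sup>+\<theta>. ennreal ((step_fun (q n) \<theta> - (\<Sum>t\<in>J. a t * g t \<theta>))\<^sup>2) \<partial>lborel) \<longlonglongrightarrow> 0"
    by (simp add: qf right_diff_distrib sum_subtractf)
  have "integrable lborel (\<lambda>\<theta>. g t \<theta> * g s \<theta>)" if "t \<in> J" "s \<in> J" for t s
    using f2 that unfolding g_def[symmetric] by (intro integrable_mult_square) auto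
  then have "integrable lborel (\<lambda>\<theta>. (\<Sum>t\<in>J. a t * g t \<theta>)\<^sup>2)"
    unfolding square_sum_mult by (intro Bochner_Integration.integrable_sum integrable_mult_right) auto
  then have "(\<lambda>n. LINT \<theta>|lborel. (step_fun (q n) \<theta>)\<^sup>2) \<longlonglongrightarrow> (LINT \<theta>|lborel. (\<Sum>t\<in>J. a t * g t \<theta>)\<^sup>2)"
    by (intro L2_convergence_norm integrable_step_fun_square q limf) measurable
  then have "(\<lambda>n. complex_of_real (exp (- (LINT \<theta>|lborel. (step_fun (q n) \<theta>)\<^sup>2) / 2)))
      \<longlonglongrightarrow> complex_of_real (exp (- (LINT \<theta>|lborel. (\<Sum>t\<in>J. a t * g t \<theta>)\<^sup>2) / 2))"
    by (intro tendsto_intros) auto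
  moreover have "(\<lambda>n. CLINT x|M. iexp (step_integral W (q n) x)) \<longlonglongrightarrow> (CLINT x|M. iexp (\<Sum>t\<in>J. a t * X t x))"
    using q by (intro L2_convergence_char limX) measurable
  ultimately show ?thesis
    unfolding step_integral_char[OF W q] g_def by (intro LIMSEQ_unique)
qed

lemma (in prob_space) process_X_char:
  assumes K: "0 < K" "K < 1"
    and W: "standard_brownian_motion M W" and X: "process_X M K W X"
    and J: "finite J" "J \<subseteq> {0..}"
  shows "(CLINT x|M. iexp (\<Sum>t\<in>J. a t * X t x))
    = exp (- (\<Sum>t\<in>J. \<Sum>s\<in>J. a t * a s * (Gamma (1 - K) / K * (t powr K + s powr K - (t + s) powr K))) / 2)"
proof -
  define f where "f t \<theta> = (1 - exp (- \<theta> * t)) * \<theta> powr (- (1 + K) / 2)" for t \<theta> :: real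
  have f: "has_bochner_integral lborel (\<lambda>\<theta>. (indicator {0..} \<theta> * f t \<theta>) * (indicator {0..} \<theta> * f s \<theta>))
     (Gamma (1 - K) / K * (t powr K + s powr K - (t + s) powr K))" if "t \<in> J" "s \<in> J" for t s
    unfolding f_def using J that by (intro has_bochner_integral_kernel_product K) auto
  have "(CLINT x|M. iexp (\<Sum>t\<in>J. a t * X t x))
     = exp (- (LINT \<theta>|lborel. (\<Sum>t\<in>J. a t * (indicator {0..} \<theta> * f t \<theta>))\<^sup>2) / 2)"
  proof (rule wiener_integrals_char[OF W J(1)])
    show "has_wiener_integral M W (f t) (X t)" if "t \<in> J" for t
      using X J that unfolding f_def process_X_def by auto
    show "integrable lborel (\<lambda>\<theta>. (indicator {0..} \<theta> * f t \<theta>)\<^sup>2)" if "t \<in> J" for t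
      unfolding power2_eq_square using f[OF that that] by (rule integrable.intros)
  qed
  also have "(LINT \<theta>|lborel. (\<Sum>t\<in>J. a t * (indicator {0..} \<theta> * f t \<theta>))\<^sup>2)
     = (\<Sum>t\<in>J. \<Sum>s\<in>J. a t * a s * (Gamma (1 - K) / K * (t powr K + s powr K - (t + s) powr K)))"
    unfolding square_sum_mult
    by (intro has_bochner_integral_integral_eq has_bochner_integral_sum has_bochner_integral_mult_right f)
  finally show ?thesis .
qed

text \<open>Bilinearity over the times \<open>t\<close>, \<open>- t\<close>, \<open>s\<close>,
  \<open>- s\<close>: the terms depending on one time only cancel in the odd part and add up in the
  even part, while \<open>\<bar>t - s\<bar>\<close> and \<open>t + s\<close> each occur
  twice.\<close>

lemma (in prob_space) fbm_even_odd_char: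
  assumes B: "two_sided_fbm M H B" and J: "finite J" "J \<subseteq> {0..}"
  shows "(CLINT x|M. iexp (\<Sum>t\<in>J. a t * odd_part B t x))
    = exp (- (\<Sum>t\<in>J. \<Sum>s\<in>J. a t * a s * (((t + s) powr (2 * H) - \<bar>t - s\<bar> powr (2 * H)) / 4)) / 2)" (is ?odd)
    and "(CLINT x|M. iexp (\<Sum>t\<in>J. a t * even_part B t x))
    = exp (- (\<Sum>t\<in>J. \<Sum>s\<in>J. a t * a s * ((2 * t powr (2 * H) + 2 * s powr (2 * H)
        - (t + s) powr (2 * H) - \<bar>t - s\<bar> powr (2 * H)) / 4)) / 2)" (is ?even)
proof -
  have G: "centered_gaussian_process M UNIV B" using B by (simp add: two_sided_fbm_def)
  have cov: "expectation (\<lambda>\<omega>. B s \<omega> * B t \<omega>) = (\<bar>t\<bar> powr (2 * H) + \<bar>s\<bar> powr (2 * H) - \<bar>t - s\<bar> powr (2 * H)) / 2" for s t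
    using B by (simp add: two_sided_fbm_def)
  have "gaussian_rv M (B t)" for t
    using G unfolding centered_gaussian_process_def by (auto dest!: spec[of _ "{t}"] spec[of _ "\<lambda>_. 1"])
  then have int: "integrable M (\<lambda>x. B s x * B t x)" for s t
    by (intro integrable_mult_square gaussian_rv_square_integrable)
  \<comment> \<open>One identity for both parts: \<open>c = - 1\<close> gives the odd part and
    \<open>c = 1\<close> the even one. At \<open>t = 0\<close> both conditionals fire, and their sum
    is still right.\<close>
  have combo: "(\<Sum>s\<in>J \<union> uminus ` J. ((if s = t then 1 else 0) + c * (if s = - t then 1 else 0)) / 2 * B s x)
      = (B t x + c * B (- t) x) / 2" if "t \<in> J" for t c x
  proof -
    have "(\<Sum>s\<in>J \<union> uminus ` J. ((if s = t then 1 else 0) + c * (if s = - t then 1 else 0)) / 2 * B s x)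
       = (\<Sum>s\<in>J \<union> uminus ` J. (if s = t then B t x / 2 else 0) + (if s = - t then c * B (- t) x / 2 else 0))"
      by (intro sum.cong) (auto simp: distrib_right add_divide_distrib)
    then show ?thesis using J that by (simp add: sum.distrib add_divide_distrib)
  qed
  have S: "finite (J \<union> uminus ` J)" "J \<union> uminus ` J \<subseteq> UNIV" using J by auto
  show ?odd
  proof (rule centered_gaussian_char[OF G J(1) S])
    show "odd_part B t x = (\<Sum>s\<in>J \<union> uminus ` J. ((if s = t then 1 else 0) + (- 1) * (if s = - t then 1 else 0)) / 2 * B s x)"
      if "t \<in> J" for t x using combo[OF that, of "- 1" x] by (simp add: odd_part_def)
    fix t s assume "t \<in> J" "s \<in> J"
    then have ts: "0 \<le> t" "0 \<le> s" using J by auto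
    have "expectation (\<lambda>x. odd_part B t x * odd_part B s x)
      = expectation (\<lambda>x. (B t x * B s x - B t x * B (- s) x - B (- t) x * B s x + B (- t) x * B (- s) x) / 4)"
      by (simp add: odd_part_def field_simps)
    also have "\<dots> = ((t + s) powr (2 * H) - \<bar>t - s\<bar> powr (2 * H)) / 4"
      using ts by (simp add: int cov abs_minus_commute add.commute field_simps)
    finally show "expectation (\<lambda>x. odd_part B t x * odd_part B s x) = ((t + s) powr (2 * H) - \<bar>t - s\<bar> powr (2 * H)) / 4" .
  qed
  show ?even
  proof (rule centered_gaussian_char[OF G J(1) S])
    show "even_part B t x = (\<Sum>s\<in>J \<union> uminus ` J. ((if s = t then 1 else 0) + 1 * (if s = - t then 1 else 0)) / 2 * B s x)"
      if "t \<in> J" for t x using combo[OF that, of 1 x] by (simp add: even_part_def)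
    fix t s assume "t \<in> J" "s \<in> J"
    then have ts: "0 \<le> t" "0 \<le> s" using J by auto
    have "expectation (\<lambda>x. even_part B t x * even_part B s x)
      = expectation (\<lambda>x. (B t x * B s x + B t x * B (- s) x + B (- t) x * B s x + B (- t) x * B (- s) x) / 4)"
      by (simp add: even_part_def field_simps)
    also have "\<dots> = (2 * t powr (2 * H) + 2 * s powr (2 * H) - (t + s) powr (2 * H) - \<bar>t - s\<bar> powr (2 * H)) / 4"
      using ts by (simp add: int cov abs_minus_commute add.commute field_simps)
    finally show "expectation (\<lambda>x. even_part B t x * even_part B s x)
      = (2 * t powr (2 * H) + 2 * s powr (2 * H) - (t + s) powr (2 * H) - \<bar>t - s\<bar> powr (2 * H)) / 4" .
  qed
qed

theorem proposition5p1:
  fixes M :: "'a measure" and K :: real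
    and W X B :: "real \<Rightarrow> 'a \<Rightarrow> real"
  assumes "prob_space M"
    and "0 < K" and "K < 1"
    and "standard_brownian_motion M W"
    and "process_X M K W X"
    and "two_sided_fbm M (K / 2) B"
    and "indep_processes M {0..} X (odd_part B)"
  shows "same_fdd M M {0..} (\<lambda>t \<omega>. C3 K powr (- 1 / 2) * X t \<omega> + odd_part B t \<omega>) (even_part B)"
proof -
  interpret prob_space M by fact
  define c where "c = C3 K powr (- 1 / 2)"
  have C3: "C3 K > 0" using assms(2,3) by (simp add: C3_def Gamma_real_pos)
  have "c\<^sup>2 * C3 K = 1"
    using C3 by (simp add: c_def powr_minus powr_half_sqrt field_simps flip: powr_power)
  \<comment> \<open>The scaled covariance of \<open>X\<close> is thus
    \<open>(t powr K + s powr K - (t + s) powr K) / 2\<close>, exactly what the odd part needs to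
    become the even part.\<close>
  then have c2: "c * c * (Gamma (1 - K) / K) = 1 / 2"
    by (simp add: C3_def power2_eq_square field_simps)
  have X [measurable]: "X t \<in> borel_measurable M" if "t \<in> {0..}" for t
    using assms(5) that by (auto simp: process_X_def has_wiener_integral_def)
  have "gaussian_rv M (B t)" for t
    using assms(6) unfolding two_sided_fbm_def centered_gaussian_process_def
    by (auto dest!: spec[of _ "{t}"] spec[of _ "\<lambda>_. 1"])
  then have [measurable]: "B t \<in> borel_measurable M" for t by (simp add: gaussian_rv_def)
  have [measurable]: "odd_part B t \<in> borel_measurable M" "even_part B t \<in> borel_measurable M" for t
    unfolding odd_part_def even_part_def by measurable
  show ?thesis
    unfolding same_fdd_def c_def[symmetric]
  proof (intro allI impI, elim conjE)
    fix J :: "real set" assume J: "finite J" "J \<subseteq> {0..}"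
    show "distr M (\<Pi>\<^sub>M t\<in>J. borel) (\<lambda>\<omega>. \<lambda>t\<in>J. c * X t \<omega> + odd_part B t \<omega>) =
        distr M (\<Pi>\<^sub>M t\<in>J. borel) (\<lambda>\<omega>. \<lambda>t\<in>J. even_part B t \<omega>)"
    proof (rule Cramer_Wold[OF assms(1) assms(1) J(1)])
      show "(\<lambda>\<omega>. c * X t \<omega> + odd_part B t \<omega>) \<in> borel_measurable M" if "t \<in> J" for t
        using that J by (intro borel_measurable_add borel_measurable_times X) auto
      fix a :: "real \<Rightarrow> real"
      define P where "P x = (\<Sum>t\<in>J. a t * c * X t x)" for x
      define Q where "Q x = (\<Sum>t\<in>J. a t * odd_part B t x)" for x
      \<comment> \<open>Independence is given for whole paths on \<open>{0..}\<close>. Composing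
        with functionals of the finitely many coordinates in \<open>J\<close>, measurable on the
        infinite product, makes the scalars \<open>P\<close> and \<open>Q\<close>
        independent.\<close>
      have "indep_var borel ((\<lambda>x. \<Sum>t\<in>J. a t * c * x t) \<circ> (\<lambda>\<omega>. \<lambda>t\<in>{0..}. X t \<omega>))
        borel ((\<lambda>x. \<Sum>t\<in>J. a t * x t) \<circ> (\<lambda>\<omega>. \<lambda>t\<in>{0..}. odd_part B t \<omega>))"
        using assms(7) J unfolding indep_processes_def
        by (intro indep_var_compose borel_measurable_sum borel_measurable_times measurable_component_singleton) auto
      also have "(\<lambda>x. \<Sum>t\<in>J. a t * c * x t) \<circ> (\<lambda>\<omega>. \<lambda>t\<in>{0..}. X t \<omega>) = P"
        using J by (auto simp: P_def fun_eq_iff intro!: sum.cong)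
      also have "(\<lambda>x. \<Sum>t\<in>J. a t * x t) \<circ> (\<lambda>\<omega>. \<lambda>t\<in>{0..}. odd_part B t \<omega>) = Q"
        using J by (auto simp: Q_def fun_eq_iff intro!: sum.cong)
      finally have PQ: "indep_var borel P borel Q" .
      then have [measurable]: "P \<in> borel_measurable M" "Q \<in> borel_measurable M"
        by (auto dest: indep_var_rv1 indep_var_rv2)
      have "(CLINT x|M. iexp (P x + Q x)) = (CLINT x|M. iexp (P x)) * (CLINT x|M. iexp (Q x))"
        using char_distr_add[OF PQ, of 1] by (simp add: char_def integral_distr)
      also have "\<dots> = complex_of_real (exp (- (\<Sum>t\<in>J. \<Sum>s\<in>J. a t * c * (a s * c) * (Gamma (1 - K) / K * (t powr K + s powr K - (t + s) powr K))) / 2))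
         * complex_of_real (exp (- (\<Sum>t\<in>J. \<Sum>s\<in>J. a t * a s * (((t + s) powr (2 * (K / 2)) - \<bar>t - s\<bar> powr (2 * (K / 2))) / 4)) / 2))"
        unfolding P_def Q_def process_X_char[OF assms(2-5) J] fbm_even_odd_char(1)[OF assms(6) J] ..
      also have "\<dots> = exp (- (\<Sum>t\<in>J. \<Sum>s\<in>J. a t * a s * ((2 * t powr K + 2 * s powr K
        - (t + s) powr K - \<bar>t - s\<bar> powr K) / 4)) / 2)"
      proof -
        have "a t * c * (a s * c) * (Gamma (1 - K) / K * (t powr K + s powr K - (t + s) powr K))
             + a t * a s * (((t + s) powr K - \<bar>t - s\<bar> powr K) / 4)
            = a t * a s * ((2 * t powr K + 2 * s powr K - (t + s) powr K - \<bar>t - s\<bar> powr K) / 4)" for t s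
        proof -
          have eq: "a t * c * (a s * c) * (Gamma (1 - K) / K * (t powr K + s powr K - (t + s) powr K))
             = a t * a s * ((c * c * (Gamma (1 - K) / K)) * (t powr K + s powr K - (t + s) powr K))"
            by (simp only: mult_ac)
          show ?thesis unfolding eq c2 by (simp add: field_simps)
        qed
        then have "(\<Sum>t\<in>J. \<Sum>s\<in>J. a t * c * (a s * c) * (Gamma (1 - K) / K * (t powr K + s powr K - (t + s) powr K)))
            + (\<Sum>t\<in>J. \<Sum>s\<in>J. a t * a s * (((t + s) powr K - \<bar>t - s\<bar> powr K) / 4))
            = (\<Sum>t\<in>J. \<Sum>s\<in>J. a t * a s * ((2 * t powr K + 2 * s powr K - (t + s) powr K - \<bar>t - s\<bar> powr K) / 4))" (is "?x + ?y = ?z")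
          by (simp only: sum.distrib[symmetric])
        then have "exp (- ?x / 2) * exp (- ?y / 2) = exp (- ?z / 2)"
          unfolding exp_add[symmetric] by (intro arg_cong[where f=exp]) linarith
        then show ?thesis by (simp only: of_real_mult[symmetric]) simp
      qed
      also have "\<dots> = (CLINT x|M. iexp (\<Sum>t\<in>J. a t * even_part B t x))"
        unfolding fbm_even_odd_char(2)[OF assms(6) J] by simp
      finally show "(CLINT x|M. iexp (\<Sum>t\<in>J. a t * (c * X t x + odd_part B t x)))
          = (CLINT x|M. iexp (\<Sum>t\<in>J. a t * even_part B t x))"
        by (simp add: P_def Q_def distrib_left sum.distrib mult.assoc)
    qed simp
  qed
qed

end
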